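(* Let $K$ be a field, let $E=K\langle e_1,\ldots,e_n\rangle$ be the exterior algebra of a $K$-vector space with basis $e_1,\ldots,e_n$, let $I\subsetneq E$ be a strongly stable ideal generated in degree $d$, and let $J$ be the colexsegment ideal associated to $I$. Then $I$ satisfies the colex lower bound, that is, $\beta_i(J)\le \beta_i(I)$ for all $i\ge 0$.
   Context: For $\sigma=\{i_1<\cdots<i_d\}\subseteq\{1,\ldots,n\}$ write $e_\sigma=e_{i_1}\wedge\cdots\wedge e_{i_d}$ (and $e_\emptyset=1$); $e_\sigma$ is called a monomial of degree $d$. A monomial ideal of $E$ is an ideal generated by monomials. $\mathrm{Mon}_d(E)$ is the set of monomials of degree $d$. A monomial ideal $I$ of $E$ is strongly stable if for each monomial $e_\sigma\in I$, each $j\in\sigma$ and each $i<j$ one has $e_i\wedge e_{\sigma\setminus\{j\}}\in I$. The ideal $I$ is generated in degree $d$ if all its minimal monomial generators have degree $d$ (here $I$ is nonzero and $d\ge1$). Reverse lexicographic order on $\mathrm{Mon}_d(E)$: for $e_\sigma=e_{i_1}\cdots e_{i_d}$ and $e_\tau=e_{j_1}\cdots e_{j_d}$ with increasing indices, $e_\sigma>_{\mathrm{revlex}}e_\tau$ if for some $1\le s\le d$ one has $i_d=j_d,\ i_{d-1}=j_{d-1},\ldots,i_{s+1}=j_{s+1}$ and $i_s<j_s$. Colexsegment ideal associated to $I$ (case of generation in one degree $d$): if $p$ is the number of minimal monomial generators of $I$, then $J$ is the ideal of $E$ generated by the $p$ largest monomials of $\mathrm{Mon}_d(E)$ in the reverse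 lexicographic order. The total Betti numbers of a graded ideal $I$ of $E$ are $\beta_i(I)=\dim_K\mathrm{Tor}_i^E(I,K)$, i.e. the ranks of the free modules in the minimal graded free resolution of $I$ over $E$. *)

theory Defs
  imports "HOL-Algebra.Ideal"
begin

section \<open>The exterior algebra\<close>

text \<open>
  An element of \<open>E = K\<langle>e\<^sub>1,\<dots>,e\<^sub>n\<rangle>\<close> is represented by its coefficients with respect to the
  basis \<open>e\<^sub>\<sigma>\<close>, \<open>\<sigma> \<subseteq> {1..n}\<close>.  The product is determined by
  \<open>e\<^sub>A \<and> e\<^sub>B = wedge_sign A B \<cdot> e\<^bsub>A \<union> B\<^esub>\<close> if \<open>A\<close> and \<open>B\<close> are disjoint,
  and \<open>e\<^sub>A \<and> e\<^sub>B = 0\<close> otherwise; the exponent counts the transpositions that sort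
  the concatenation of \<open>A\<close> and \<open>B\<close>.
\<close>

definition wedge_sign :: "nat set \<Rightarrow> nat set \<Rightarrow> 'k::field" where
  "wedge_sign A B = (-1) ^ card {(a, b). a \<in> A \<and> b \<in> B \<and> b < a}"

definition exterior :: "nat \<Rightarrow> (nat set \<Rightarrow> 'k::field) ring" where
  "exterior n =
     \<lparr>carrier = {f. \<forall>S. f S \<noteq> 0 \<longrightarrow> S \<subseteq> {1..n}},
      mult = (\<lambda>f g S. \<Sum>A\<in>Pow S. wedge_sign A (S - A) * f A * g (S - A)),
      one = (\<lambda>S. if S = {} then 1 else 0),
      zero = (\<lambda>S. 0),
      add = (\<lambda>f g S. f S + g S)\<rparr>"

definition emon :: "nat set \<Rightarrow> nat set \<Rightarrow> 'k::field" where
  "emon \<sigma> = (\<lambda>S. if S = \<sigma> then 1 else 0)"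

lemma wedge_sign_Un_left:
  assumes "finite A" "finite B" "finite C" "A \<inter> B = {}"
  shows "(wedge_sign (A \<union> B) C :: 'k::field) = wedge_sign A C * wedge_sign B C"
proof -
  let ?P = "\<lambda>A. {(a, b). a \<in> A \<and> b \<in> C \<and> b < a}"
  have fin: "finite (?P A)" if "finite A" for A
    by (rule finite_subset[of _ "A \<times> C"]) (use that assms(3) in auto)
  have "?P (A \<union> B) = ?P A \<union> ?P B" "?P A \<inter> ?P B = {}"
    using assms(4) by auto
  then show ?thesis
    unfolding wedge_sign_def
    by (simp add: card_Un_disjoint[OF fin[OF assms(1)] fin[OF assms(2)]] power_add)
qed

lemma wedge_sign_Un_right:
  assumes "finite A" "finite B" "finite C" "B \<inter> C = {}"
  shows "(wedge_sign A (B \<union> C) :: 'k::field) = wedge_sign A B * wedge_sign A C"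
proof -
  let ?P = "\<lambda>B. {(a, b). a \<in> A \<and> b \<in> B \<and> b < a}"
  have fin: "finite (?P B)" if "finite B" for B
    by (rule finite_subset[of _ "A \<times> B"]) (use that assms(1) in auto)
  have "?P (B \<union> C) = ?P B \<union> ?P C" "?P B \<inter> ?P C = {}"
    using assms(4) by auto
  then show ?thesis
    unfolding wedge_sign_def
    by (simp add: card_Un_disjoint[OF fin[OF assms(2)] fin[OF assms(3)]] power_add)
qed

lemma wedge_sign_empty [simp]: "wedge_sign {} B = 1" "wedge_sign A {} = 1"
  by (simp_all add: wedge_sign_def)

lemma exterior_mult_nonzeroE:
  assumes "(f \<otimes>\<^bsub>exterior n\<^esub> g) S \<noteq> 0"
  obtains A where "A \<subseteq> S" "f A \<noteq> 0" "g (S - A) \<noteq> 0"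
proof -
  have "(\<Sum>A\<in>Pow S. wedge_sign A (S - A) * f A * g (S - A)) \<noteq> 0"
    using assms by (simp add: exterior_def)
  then obtain A where "A \<in> Pow S" "wedge_sign A (S - A) * f A * g (S - A) \<noteq> 0"
    by (rule sum.not_neutral_contains_not_neutral)
  then show thesis by (intro that) auto
qed

lemma exterior_mult_closed:
  assumes "f \<in> carrier (exterior n)" "g \<in> carrier (exterior n)"
  shows "f \<otimes>\<^bsub>exterior n\<^esub> g \<in> carrier (exterior n)"
proof -
  have "S \<subseteq> {1..n}" if nz: "(f \<otimes>\<^bsub>exterior n\<^esub> g) S \<noteq> 0" for S
  proof -
    obtain A where A: "A \<subseteq> S" "f A \<noteq> 0" "g (S - A) \<noteq> 0"
      using nz by (rule exterior_mult_nonzeroE)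
    then have "A \<subseteq> {1..n}" "S - A \<subseteq> {1..n}"
      using assms by (simp_all add: exterior_def)
    then show ?thesis by blast
  qed
  then show ?thesis by (simp add: exterior_def)
qed

lemma exterior_mult_assoc:
  "(f \<otimes>\<^bsub>exterior n\<^esub> g) \<otimes>\<^bsub>exterior n\<^esub> h = f \<otimes>\<^bsub>exterior n\<^esub> (g \<otimes>\<^bsub>exterior n\<^esub> h)"
proof
  fix S :: "nat set"
  show "((f \<otimes>\<^bsub>exterior n\<^esub> g) \<otimes>\<^bsub>exterior n\<^esub> h) S = (f \<otimes>\<^bsub>exterior n\<^esub> (g \<otimes>\<^bsub>exterior n\<^esub> h)) S"
  proof (cases "finite S")
    case False
    then show ?thesis by (simp add: exterior_def)
  next
    case True
    let ?l = "\<lambda>(A, B). wedge_sign A (S - A) * (wedge_sign B (A - B) * f B * g (A - B)) * h (S - A)"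
    let ?r = "\<lambda>(B, C). wedge_sign B (S - B) * f B *
                 (wedge_sign C (S - B - C) * g C * h (S - B - C))"
    have fin: "finite X" if "X \<subseteq> S" for X
      using True that by (rule rev_finite_subset)
    have "((f \<otimes>\<^bsub>exterior n\<^esub> g) \<otimes>\<^bsub>exterior n\<^esub> h) S = sum ?l (Sigma (Pow S) Pow)"
      using fin True
      by (simp add: exterior_def sum_distrib_left sum_distrib_right sum.Sigma)
    also have "\<dots> = sum ?r (SIGMA B:Pow S. Pow (S - B))"
    proof (rule sum.reindex_bij_witness[where i = "\<lambda>(B, C). (B \<union> C, B)" and j = "\<lambda>(A, B). (B, A - B)"],
           goal_cases)
      case (5 p)
      obtain A B where p: "p = (A, B)" by (cases p)
      with 5 have sub: "A \<subseteq> S" "B \<subseteq> A" by auto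
      let ?C = "A - B" and ?D = "S - A"
      have A: "B \<union> ?C = A" and SB: "?C \<union> ?D = S - B" and D: "S - B - ?C = ?D"
        using sub by auto
      have f: "finite B" "finite ?C" "finite ?D"
        using sub by (auto intro: fin)
      have "(wedge_sign A ?D :: 'a) = wedge_sign B ?D * wedge_sign ?C ?D"
        using wedge_sign_Un_left[OF f] unfolding A by auto
      moreover have "(wedge_sign B (S - B) :: 'a) = wedge_sign B ?C * wedge_sign B ?D"
        using wedge_sign_Un_right[OF f] unfolding SB by auto
      ultimately show ?case
        by (simp add: p D mult_ac)
    qed auto
    also have "\<dots> = (f \<otimes>\<^bsub>exterior n\<^esub> (g \<otimes>\<^bsub>exterior n\<^esub> h)) S"
      using fin True
      by (simp add: exterior_def sum_distrib_left sum_distrib_right sum.Sigma)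
    finally show ?thesis .
  qed
qed

lemma emon_mult:
  assumes "finite A" "finite B"
  shows "emon A \<otimes>\<^bsub>exterior n\<^esub> emon B =
    (if A \<inter> B = {} then (\<lambda>S. wedge_sign A B * emon (A \<union> B) S) else \<zero>\<^bsub>exterior n\<^esub>)"
proof
  fix S :: "nat set"
  have "(emon A \<otimes>\<^bsub>exterior n\<^esub> emon B) S =
      (\<Sum>X\<in>Pow S. if X = A then (if S - A = B then wedge_sign A B else 0) else 0)"
    unfolding exterior_def emon_def ring_record_simps by (rule sum.cong) auto
  also have "\<dots> = (if A \<subseteq> S \<and> S - A = B then wedge_sign A B else 0)"
  proof (cases "finite S")
    case True
    then show ?thesis by (subst sum.delta) auto
  next
    case False
    then have "\<not> (A \<subseteq> S \<and> S - A = B)" using assms by (metis Diff_infinite_finite)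
    then show ?thesis by (subst sum.neutral) auto
  qed
  also have "A \<subseteq> S \<and> S - A = B \<longleftrightarrow> A \<inter> B = {} \<and> S = A \<union> B" by auto
  finally have eq: "(emon A \<otimes>\<^bsub>exterior n\<^esub> emon B) S =
    (if A \<inter> B = {} \<and> S = A \<union> B then wedge_sign A B else 0)" .
  show "(emon A \<otimes>\<^bsub>exterior n\<^esub> emon B) S =
    (if A \<inter> B = {} then (\<lambda>S. wedge_sign A B * emon (A \<union> B) S) else \<zero>\<^bsub>exterior n\<^esub>) S"
    unfolding eq by (simp add: emon_def exterior_def)
qed

text \<open>In particular \<open>e\<^sub>\<sigma> = e\<^bsub>i\<^sub>1\<^esub> \<and> \<dots> \<and> e\<^bsub>i\<^sub>d\<^esub>\<close> for \<open>\<sigma> = {i\<^sub>1 < \<dots> < i\<^sub>d}\<close>, by iterating:\<close>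

lemma emon_insert:
  assumes "finite \<sigma>" "\<forall>j\<in>\<sigma>. i < j"
  shows "emon (insert i \<sigma>) = emon {i} \<otimes>\<^bsub>exterior n\<^esub> emon \<sigma>"
proof -
  have "{(a, b). a \<in> {i} \<and> b \<in> \<sigma> \<and> b < a} = {}" using assms by auto
  then have "wedge_sign {i} \<sigma> = 1" unfolding wedge_sign_def by (metis card.empty power_0)
  then show ?thesis using assms by (auto simp: emon_mult)
qed

lemma exterior_one_mult: "\<one>\<^bsub>exterior n\<^esub> \<otimes>\<^bsub>exterior n\<^esub> f = f"
  if "f \<in> carrier (exterior n)"
proof
  fix S :: "nat set"
  have "(\<one>\<^bsub>exterior n\<^esub> \<otimes>\<^bsub>exterior n\<^esub> f) S = (\<Sum>X\<in>Pow S. if X = {} then f S else 0)"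
    by (auto simp: exterior_def intro!: sum.cong)
  also have "\<dots> = f S"
    using that finite_subset[of S "{1..n}"] by (cases "finite S") (auto simp: exterior_def)
  finally show "(\<one>\<^bsub>exterior n\<^esub> \<otimes>\<^bsub>exterior n\<^esub> f) S = f S" .
qed

lemma exterior_mult_one: "f \<otimes>\<^bsub>exterior n\<^esub> \<one>\<^bsub>exterior n\<^esub> = f"
  if "f \<in> carrier (exterior n)"
proof
  fix S :: "nat set"
  have "(f \<otimes>\<^bsub>exterior n\<^esub> \<one>\<^bsub>exterior n\<^esub>) S = (\<Sum>X\<in>Pow S. if X = S then f S else 0)"
    by (auto simp: exterior_def intro!: sum.cong)
  also have "\<dots> = f S"
    using that finite_subset[of S "{1..n}"] by (cases "finite S") (auto simp: exterior_def)
  finally show "(f \<otimes>\<^bsub>exterior n\<^esub> \<one>\<^bsub>exterior n\<^esub>) S = f S" .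
qed

lemma ring_exterior: "ring (exterior n :: (nat set \<Rightarrow> 'k::field) ring)"
proof (rule ringI)
  show "abelian_group (exterior n :: (nat set \<Rightarrow> 'k) ring)"
  proof (rule abelian_groupI)
    fix f :: "nat set \<Rightarrow> 'k" assume "f \<in> carrier (exterior n)"
    then have "(\<lambda>S. - f S) \<in> carrier (exterior n)"
      "(\<lambda>S. - f S) \<oplus>\<^bsub>exterior n\<^esub> f = \<zero>\<^bsub>exterior n\<^esub>"
      by (simp_all add: exterior_def)
    then show "\<exists>g\<in>carrier (exterior n). g \<oplus>\<^bsub>exterior n\<^esub> f = \<zero>\<^bsub>exterior n\<^esub>" by blast
  next
    fix f g :: "nat set \<Rightarrow> 'k"
    assume "f \<in> carrier (exterior n)" "g \<in> carrier (exterior n)"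
    then show "f \<oplus>\<^bsub>exterior n\<^esub> g \<in> carrier (exterior n)"
      by (simp add: exterior_def) (metis add_0)
  qed (simp_all add: exterior_def add_ac)
  show "Group.monoid (exterior n :: (nat set \<Rightarrow> 'k) ring)"
    by (rule monoidI)
      (simp_all add: exterior_mult_closed exterior_mult_assoc exterior_one_mult exterior_mult_one,
       simp add: exterior_def)
qed (simp_all add: exterior_def fun_eq_iff algebra_simps sum.distrib)


section \<open>Monomial ideals\<close>

definition monomial_ideal :: "nat \<Rightarrow> (nat set \<Rightarrow> 'k::field) set \<Rightarrow> bool" where
  "monomial_ideal n I \<longleftrightarrow> (\<exists>G \<subseteq> Pow {1..n}. I = Idl\<^bsub>exterior n\<^esub> (emon ` G))"

definition strongly_stable :: "nat \<Rightarrow> (nat set \<Rightarrow> 'k::field) set \<Rightarrow> bool" where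
  "strongly_stable n I \<longleftrightarrow> monomial_ideal n I \<and>
     (\<forall>\<sigma>. \<sigma> \<subseteq> {1..n} \<and> emon \<sigma> \<in> I \<longrightarrow>
        (\<forall>j\<in>\<sigma>. \<forall>i\<in>{1..<j}. emon {i} \<otimes>\<^bsub>exterior n\<^esub> emon (\<sigma> - {j}) \<in> I))"

text \<open>
  The minimal monomial generators of \<open>I\<close>, given by their index sets.  The monomial \<open>e\<^sub>\<tau>\<close>
  divides \<open>e\<^sub>\<sigma>\<close> iff \<open>\<tau> \<subseteq> \<sigma>\<close>; see \<open>min_gens_generate\<close> and \<open>min_gens_least\<close> below.
\<close>

definition min_gens :: "nat \<Rightarrow> (nat set \<Rightarrow> 'k::field) set \<Rightarrow> nat set set" where
  "min_gens n I = {\<sigma>. \<sigma> \<subseteq> {1..n} \<and> emon \<sigma> \<in> I \<and> (\<forall>\<tau>. \<tau> \<subset> \<sigma> \<longrightarrow> emon \<tau> \<notin> I)}"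

definition generated_in_degree :: "nat \<Rightarrow> nat \<Rightarrow> (nat set \<Rightarrow> 'k::field) set \<Rightarrow> bool" where
  "generated_in_degree n d I \<longleftrightarrow>
     I \<noteq> {\<zero>\<^bsub>exterior n\<^esub>} \<and> d \<ge> 1 \<and> (\<forall>\<sigma>\<in>min_gens n I. card \<sigma> = d)"

lemma emon_carrier: "\<sigma> \<subseteq> {1..n} \<Longrightarrow> emon \<sigma> \<in> carrier (exterior n)"
  by (simp add: exterior_def emon_def)

lemma ideal_multiples:
  fixes G :: "nat set set" and n :: nat and M :: "(nat set \<Rightarrow> 'k::field) set"
  defines "M \<equiv> {f \<in> carrier (exterior n). \<forall>S. f S \<noteq> 0 \<longrightarrow> (\<exists>\<tau>\<in>G. \<tau> \<subseteq> S)}"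
  shows "ideal M (exterior n)"
proof (rule idealI)
  interpret ring "exterior n :: (nat set \<Rightarrow> 'k) ring" by (rule ring_exterior)
  show "ring (exterior n :: (nat set \<Rightarrow> 'k) ring)" by (rule ring_exterior)
  show "subgroup M (add_monoid (exterior n))"
  proof (rule add.subgroupI)
    fix f assume f: "f \<in> M"
    have "(\<lambda>S. - f S) \<oplus>\<^bsub>exterior n\<^esub> f = \<zero>\<^bsub>exterior n\<^esub>"
      by (simp add: exterior_def)
    then have "\<ominus>\<^bsub>exterior n\<^esub> f = (\<lambda>S. - f S)"
      using f by (intro minus_equality) (auto simp: M_def exterior_def)
    then show "\<ominus>\<^bsub>exterior n\<^esub> f \<in> M" using f by (simp add: M_def exterior_def)
  next
    fix f g assume "f \<in> M" "g \<in> M"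
    then show "f \<oplus>\<^bsub>exterior n\<^esub> g \<in> M"
      by (simp add: M_def exterior_def) (metis add_0)
  qed (auto simp: M_def exterior_def)
  fix f g :: "nat set \<Rightarrow> 'k" assume f: "f \<in> M" and g: "g \<in> carrier (exterior n)"
  have "\<exists>\<tau>\<in>G. \<tau> \<subseteq> S" if nz: "(f \<otimes>\<^bsub>exterior n\<^esub> g) S \<noteq> 0" for S
  proof -
    obtain A where A: "A \<subseteq> S" "f A \<noteq> 0" "g (S - A) \<noteq> 0"
      using nz by (rule exterior_mult_nonzeroE)
    with f obtain \<tau> where "\<tau> \<in> G" "\<tau> \<subseteq> A"
      unfolding M_def by blast
    then show ?thesis using A(1) by blast
  qed
  then show "f \<otimes>\<^bsub>exterior n\<^esub> g \<in> M"
    using f g exterior_mult_closed by (auto simp: M_def)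
  have "\<exists>\<tau>\<in>G. \<tau> \<subseteq> S" if nz: "(g \<otimes>\<^bsub>exterior n\<^esub> f) S \<noteq> 0" for S
  proof -
    obtain A where A: "A \<subseteq> S" "g A \<noteq> 0" "f (S - A) \<noteq> 0"
      using nz by (rule exterior_mult_nonzeroE)
    with f obtain \<tau> where "\<tau> \<in> G" "\<tau> \<subseteq> S - A"
      unfolding M_def by blast
    then show ?thesis using A(1) by blast
  qed
  then show "g \<otimes>\<^bsub>exterior n\<^esub> f \<in> M"
    using f g exterior_mult_closed by (auto simp: M_def)
qed

lemma emon_in_Idl_iff:
  assumes "G \<subseteq> Pow {1..n}" "\<sigma> \<subseteq> {1..n}"
  shows "(emon \<sigma> :: nat set \<Rightarrow> 'k::field) \<in> Idl\<^bsub>exterior n\<^esub> (emon ` G) \<longleftrightarrow> (\<exists>\<tau>\<in>G. \<tau> \<subseteq> \<sigma>)"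
proof
  interpret ring "exterior n :: (nat set \<Rightarrow> 'k) ring" by (rule ring_exterior)
  let ?M = "{f \<in> carrier (exterior n). \<forall>S. f S \<noteq> (0::'k) \<longrightarrow> (\<exists>\<tau>\<in>G. \<tau> \<subseteq> S)}"
  have "emon ` G \<subseteq> ?M"
  proof
    fix f :: "nat set \<Rightarrow> 'k" assume "f \<in> emon ` G"
    then obtain \<tau> where "\<tau> \<in> G" "f = emon \<tau>" by blast
    moreover from this have "\<tau> \<subseteq> {1..n}" using assms(1) by blast
    ultimately show "f \<in> ?M" using emon_carrier by (auto simp: emon_def)
  qed
  then have "Idl\<^bsub>exterior n\<^esub> (emon ` G) \<subseteq> ?M"
    by (rule genideal_minimal[OF ideal_multiples])
  moreover assume "(emon \<sigma> :: nat set \<Rightarrow> 'k) \<in> Idl\<^bsub>exterior n\<^esub> (emon ` G)"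
  ultimately have "(emon \<sigma> :: nat set \<Rightarrow> 'k) \<in> ?M" by (rule subsetD)
  then have "emon \<sigma> \<sigma> \<noteq> (0::'k) \<longrightarrow> (\<exists>\<tau>\<in>G. \<tau> \<subseteq> \<sigma>)" by blast
  then show "\<exists>\<tau>\<in>G. \<tau> \<subseteq> \<sigma>" by (simp add: emon_def)
next
  interpret ring "exterior n :: (nat set \<Rightarrow> 'k) ring" by (rule ring_exterior)
  assume "\<exists>\<tau>\<in>G. \<tau> \<subseteq> \<sigma>"
  then obtain \<tau> where \<tau>: "\<tau> \<in> G" "\<tau> \<subseteq> \<sigma>" by blast
  have sub: "(emon ` G :: (nat set \<Rightarrow> 'k) set) \<subseteq> carrier (exterior n)"
    using assms(1) emon_carrier by blast
  interpret ideal "Idl\<^bsub>exterior n\<^esub> (emon ` G :: (nat set \<Rightarrow> 'k) set)" "exterior n"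
    using sub by (rule genideal_ideal)
  let ?\<rho> = "\<sigma> - \<tau>"
  have fin: "finite \<tau>" "finite ?\<rho>"
    using assms \<tau> by (auto intro: finite_subset)
  let ?s = "wedge_sign \<tau> ?\<rho> :: 'k"
  have s: "?s * ?s = 1"
    unfolding wedge_sign_def by (simp flip: power_mult_distrib)
  let ?c = "\<lambda>S. ?s * emon ?\<rho> S"
  have c: "?c \<in> carrier (exterior n)"
    using assms(2) by (auto simp: exterior_def emon_def)
  have "emon \<tau> \<otimes>\<^bsub>exterior n\<^esub> ?c = (\<lambda>S. ?s * (emon \<tau> \<otimes>\<^bsub>exterior n\<^esub> emon ?\<rho>) S)"
    by (rule ext) (simp add: exterior_def sum_distrib_left mult_ac)
  also have "\<dots> = emon \<sigma>"
    using \<tau>(2) by (simp add: emon_mult[OF fin] Un_absorb1 s flip: mult.assoc)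
  finally have eq: "emon \<tau> \<otimes>\<^bsub>exterior n\<^esub> ?c = emon \<sigma>" .
  have "emon \<tau> \<in> Idl\<^bsub>exterior n\<^esub> (emon ` G :: (nat set \<Rightarrow> 'k) set)"
    using genideal_self[OF sub] \<tau>(1) by blast
  from I_r_closed[OF this c] show "(emon \<sigma> :: nat set \<Rightarrow> 'k) \<in> Idl\<^bsub>exterior n\<^esub> (emon ` G)"
    unfolding eq .
qed

lemma min_gens_subset_gens:
  assumes "G \<subseteq> Pow {1..n}"
  shows "min_gens n (Idl\<^bsub>exterior n\<^esub> (emon ` G) :: (nat set \<Rightarrow> 'k::field) set) \<subseteq> G"
proof
  let ?I = "Idl\<^bsub>exterior n\<^esub> (emon ` G) :: (nat set \<Rightarrow> 'k) set"
  fix \<sigma> assume "\<sigma> \<in> min_gens n ?I"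
  then have \<sigma>: "\<sigma> \<subseteq> {1..n}" "emon \<sigma> \<in> ?I" "\<And>\<tau>. \<tau> \<subset> \<sigma> \<Longrightarrow> emon \<tau> \<notin> ?I"
    by (simp_all add: min_gens_def)
  obtain \<tau> where \<tau>: "\<tau> \<in> G" "\<tau> \<subseteq> \<sigma>"
    using \<sigma>(2) unfolding emon_in_Idl_iff[OF assms \<sigma>(1)] by blast
  have "\<tau> \<subseteq> {1..n}" using \<tau>(2) \<sigma>(1) by (rule order_trans)
  then have "emon \<tau> \<in> ?I" using \<tau>(1) by (subst emon_in_Idl_iff[OF assms]) auto
  then have "\<not> \<tau> \<subset> \<sigma>" using \<sigma>(3) by metis
  then show "\<sigma> \<in> G" using \<tau> by (metis psubsetI)
qed

lemma min_gens_generate: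
  assumes "monomial_ideal n (I :: (nat set \<Rightarrow> 'k::field) set)"
  shows "Idl\<^bsub>exterior n\<^esub> (emon ` min_gens n I) = I"
proof
  interpret ring "exterior n :: (nat set \<Rightarrow> 'k) ring" by (rule ring_exterior)
  obtain G where G: "G \<subseteq> Pow {1..n}" "I = Idl\<^bsub>exterior n\<^esub> (emon ` G)"
    using assms by (auto simp: monomial_ideal_def)
  have sub: "emon ` X \<subseteq> (carrier (exterior n) :: (nat set \<Rightarrow> 'k) set)" if "X \<subseteq> Pow {1..n}" for X
    using that emon_carrier by blast
  have mg: "min_gens n I \<subseteq> Pow {1..n}" by (auto simp: min_gens_def)
  show "Idl\<^bsub>exterior n\<^esub> (emon ` min_gens n I) \<subseteq> I"
    unfolding G(2)
    by (rule genideal_minimal[OF genideal_ideal[OF sub[OF G(1)]]]) (auto simp: min_gens_def)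
  have "emon \<sigma> \<in> Idl\<^bsub>exterior n\<^esub> (emon ` min_gens n I)" if "\<sigma> \<in> G" for \<sigma>
  proof -
    have "\<sigma> \<subseteq> {1..n}" using that G by auto
    then have "finite \<sigma>" by (rule finite_subset) simp
    moreover have "emon \<sigma> \<in> I" using genideal_self[OF sub[OF G(1)]] that G(2) by blast
    ultimately have "\<exists>\<tau>\<in>min_gens n I. \<tau> \<subseteq> \<sigma>" using \<open>\<sigma> \<subseteq> {1..n}\<close>
    proof (induction \<sigma> rule: finite_psubset_induct)
      case (psubset \<sigma>)
      show ?case
      proof (cases "\<sigma> \<in> min_gens n I")
        case False
        then obtain \<tau> where "\<tau> \<subset> \<sigma>" "emon \<tau> \<in> I"
          using psubset.prems by (auto simp: min_gens_def)
        with psubset show ?thesis by (meson dual_order.strict_implies_order order_trans)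
      qed blast
    qed
    then show ?thesis using emon_in_Idl_iff[OF mg \<open>\<sigma> \<subseteq> {1..n}\<close>] by blast
  qed
  then show "I \<subseteq> Idl\<^bsub>exterior n\<^esub> (emon ` min_gens n I)"
    by (subst G(2), intro genideal_minimal[OF genideal_ideal[OF sub[OF mg]]]) blast
qed

lemma min_gens_least:
  assumes "G \<subseteq> Pow {1..n}" "Idl\<^bsub>exterior n\<^esub> (emon ` G) = (I :: (nat set \<Rightarrow> 'k::field) set)"
  shows "min_gens n I \<subseteq> G"
  using min_gens_subset_gens assms by metis


section \<open>The colexsegment ideal\<close>

definition Mon :: "nat \<Rightarrow> nat \<Rightarrow> nat set set" where
  "Mon n d = {\<sigma>. \<sigma> \<subseteq> {1..n} \<and> card \<sigma> = d}"

text \<open>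
  Monomials of degree \<open>d\<close> are given by their index sets, and \<open>sorted_list_of_set \<sigma> ! (s - 1)\<close> is the
  \<open>s\<close>-th smallest index \<open>i\<^sub>s\<close>.  A monomial is among the \<open>p\<close> largest iff fewer than \<open>p\<close> are larger.
\<close>

definition revlex_gt :: "nat \<Rightarrow> nat set \<Rightarrow> nat set \<Rightarrow> bool" where
  "revlex_gt d \<sigma> \<tau> \<longleftrightarrow>
     (\<exists>s<d. (\<forall>t. s < t \<and> t < d \<longrightarrow> sorted_list_of_set \<sigma> ! t = sorted_list_of_set \<tau> ! t) \<and>
            sorted_list_of_set \<sigma> ! s < sorted_list_of_set \<tau> ! s)"

definition largest_monomials :: "nat \<Rightarrow> nat \<Rightarrow> nat \<Rightarrow> nat set set" where
  "largest_monomials n d p = {\<sigma> \<in> Mon n d. card {\<tau> \<in> Mon n d. revlex_gt d \<tau> \<sigma>} < p}"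

definition colexsegment_ideal ::
    "nat \<Rightarrow> nat \<Rightarrow> (nat set \<Rightarrow> 'k::field) set \<Rightarrow> (nat set \<Rightarrow> 'k) set" where
  "colexsegment_ideal n d I =
     Idl\<^bsub>exterior n\<^esub> (emon ` largest_monomials n d (card (min_gens n I)))"


section \<open>Minimal graded free resolutions and Betti numbers\<close>

text \<open>
  The free left module \<open>E\<^sup>r\<close>, as sequences vanishing from position \<open>r\<close> on, and the
  \<open>E\<close>-linear map out of \<open>E\<^sup>r\<close> that sends the \<open>j\<close>-th basis vector to \<open>A j\<close>.
\<close>

definition free_mod :: "nat \<Rightarrow> nat \<Rightarrow> (nat \<Rightarrow> nat set \<Rightarrow> 'k::field) set" where
  "free_mod n r =
     {x. (\<forall>j<r. x j \<in> carrier (exterior n)) \<and> (\<forall>j\<ge>r. x j = \<zero>\<^bsub>exterior n\<^esub>)}"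

definition free_map ::
    "nat \<Rightarrow> nat \<Rightarrow> (nat \<Rightarrow> nat \<Rightarrow> nat set \<Rightarrow> 'k::field) \<Rightarrow>
     (nat \<Rightarrow> nat set \<Rightarrow> 'k) \<Rightarrow> (nat \<Rightarrow> nat set \<Rightarrow> 'k)" where
  "free_map n r A x = (\<lambda>k. \<Oplus>\<^bsub>exterior n\<^esub>j\<in>{..<r}. x j \<otimes>\<^bsub>exterior n\<^esub> A j k)"

definition free_aug ::
    "nat \<Rightarrow> nat \<Rightarrow> (nat \<Rightarrow> nat set \<Rightarrow> 'k::field) \<Rightarrow> (nat \<Rightarrow> nat set \<Rightarrow> 'k) \<Rightarrow> (nat set \<Rightarrow> 'k)" where
  "free_aug n r g x = (\<Oplus>\<^bsub>exterior n\<^esub>j\<in>{..<r}. x j \<otimes>\<^bsub>exterior n\<^esub> g j)"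

definition homogeneous :: "int \<Rightarrow> (nat set \<Rightarrow> 'k::field) \<Rightarrow> bool" where
  "homogeneous c f \<longleftrightarrow> (\<forall>S. f S \<noteq> 0 \<longrightarrow> int (card S) = c)"

definition irrelevant_ideal :: "nat \<Rightarrow> (nat set \<Rightarrow> 'k::field) set" where
  "irrelevant_ideal n = Idl\<^bsub>exterior n\<^esub> ((\<lambda>i. emon {i}) ` {1..n})"

text \<open>
  A minimal graded free resolution \<open>\<dots> \<rightarrow> F\<^sub>1 \<rightarrow> F\<^sub>0 \<rightarrow> I \<rightarrow> 0\<close>:
  \<open>F\<^sub>i\<close> is free of rank \<open>b i\<close> with basis elements in degrees \<open>a i 0, a i 1, \<dots>\<close>; the augmentation
  sends the \<open>j\<close>-th basis element of \<open>F\<^sub>0\<close> to \<open>g j\<close>, and the differential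
  sends the \<open>j\<close>-th basis element of \<open>F\<^bsub>i+1\<^esub>\<close> to \<open>D i j \<in> F\<^sub>i\<close>.
  All maps are of degree \<open>0\<close>, and minimality is the condition that the image of \<open>F\<^bsub>i+1\<^esub>\<close> lies in
  \<open>(e\<^sub>1,\<dots>,e\<^sub>n) F\<^sub>i\<close>.
\<close>

definition min_graded_free_resolution ::
    "nat \<Rightarrow> (nat set \<Rightarrow> 'k::field) set \<Rightarrow> (nat \<Rightarrow> nat) \<Rightarrow> (nat \<Rightarrow> nat \<Rightarrow> int) \<Rightarrow>
     (nat \<Rightarrow> nat set \<Rightarrow> 'k) \<Rightarrow> (nat \<Rightarrow> nat \<Rightarrow> nat \<Rightarrow> nat set \<Rightarrow> 'k) \<Rightarrow> bool" where
  "min_graded_free_resolution n I b a g D \<longleftrightarrow>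
     (\<forall>j<b 0. g j \<in> carrier (exterior n) \<and> homogeneous (a 0 j) (g j)) \<and>
     (\<forall>i. \<forall>j<b (Suc i). D i j \<in> free_mod n (b i) \<and>
        (\<forall>k<b i. homogeneous (a (Suc i) j - a i k) (D i j k))) \<and>
     free_aug n (b 0) g ` free_mod n (b 0) = I \<and>
     free_map n (b 1) (D 0) ` free_mod n (b 1) =
       {x \<in> free_mod n (b 0). free_aug n (b 0) g x = \<zero>\<^bsub>exterior n\<^esub>} \<and>
     (\<forall>i. free_map n (b (i + 2)) (D (i + 1)) ` free_mod n (b (i + 2)) =
       {x \<in> free_mod n (b (i + 1)). free_map n (b (i + 1)) (D i) x = (\<lambda>k. \<zero>\<^bsub>exterior n\<^esub>)}) \<and>
     (\<forall>i. \<forall>j<b (Suc i). \<forall>k<b i. D i j k \<in> irrelevant_ideal n)"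

text \<open>
  The total Betti number \<open>\<beta>\<^sub>i(I)\<close>.  Minimal graded free resolutions of a graded ideal exist and are unique
  up to isomorphism, so the description is well-defined for such \<open>I\<close>.
\<close>

definition betti :: "nat \<Rightarrow> (nat set \<Rightarrow> 'k::field) set \<Rightarrow> nat \<Rightarrow> nat" where
  "betti n I i = (THE r. \<exists>b a g D. min_graded_free_resolution n I b a g D \<and> r = b i)"

end

theory Submission
  imports Defs "HOL-Library.Function_Algebras" HOL.Vector_Spaces
begin

text \<open>
  Both \<open>I\<close> and \<open>J\<close> are stable ideals generated in the single degree \<open>d\<close>, and for such an ideal
  with set of generators \<open>G\<close> the Betti numbers are \<open>\<beta>\<^sub>i = \<Sum>u\<in>G. \<beta>\<^sub>i(max u)\<close>, where \<open>\<beta>\<^sub>i(m)\<close> is the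
  \<open>i\<close>-th Betti number of \<open>E / (e\<^sub>1,\<dots>,e\<^sub>m)\<close>, a function that increases with \<open>m\<close> (in closed form it is
  the binomial coefficient \<open>m + i - 1\<close> over \<open>i\<close>).  The largest index of a monomial grows along the
  reverse lexicographic order, so of all sets of \<open>p\<close> monomials the \<open>p\<close> revlex-largest ones have the
  smallest largest indices.  As \<open>I\<close> and \<open>J\<close> have equally many generators, the sum for \<open>J\<close> is at
  most the sum for \<open>I\<close>.

  The formula rests on linear quotients.  If the generators of \<open>I\<close> are listed by increasing
  largest index, then the ideal of those \<open>f\<close> for which \<open>f \<and> e\<^sub>u\<close> lies in the span of the
  earlier generators is exactly \<open>(e\<^sub>1,\<dots>,e\<^sub>m)\<close> with \<open>m = max u\<close> (\<open>colon_of_monomial\<close>).  The class of modules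
  with generators \<open>x\<^sub>1,\<dots>,x\<^sub>p\<close> of one degree whose successive colon ideals have the form
  \<open>(e\<^sub>1,\<dots>,e\<^bsub>m\<^esub>)\<close>, with \<open>m\<close> depending on the generator, is closed under passing to syzygies
  (\<open>linear_quotients_syzygies\<close>): filtering the syzygies by their last nonzero coordinate, the quotients
  are the ideals \<open>(e\<^sub>1,\<dots>,e\<^sub>m)\<close>, and in the exterior algebra the colon ideal
  \<open>(e\<^sub>1,\<dots>,e\<^bsub>l-1\<^esub>) : e\<^sub>l\<close> is \<open>(e\<^sub>1,\<dots>,e\<^sub>l)\<close>, because \<open>e\<^sub>l \<and> e\<^sub>l = 0\<close>.  A generator with bound \<open>m\<close>
  thus gives rise to syzygies, with linear entries, of bounds \<open>1, \<dots>, m\<close>.  Iterating yields a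
  resolution that is linear, hence minimal, and whose ranks are counted by \<open>var_syzygies\<close>.

  A Betti number is defined as the common rank in all minimal resolutions, so their ranks have to be shown
  to agree.  Two minimal covers of isomorphic modules are isomorphic
  (\<open>minimal_cover_unique\<close>): lifts in both directions compose to endomorphisms which are the identity modulo
  \<open>(e\<^sub>1,\<dots>,e\<^sub>n)\<close>, an ideal that is nilpotent.  So the kernels are isomorphic as well, and induction
  on the homological degree applies.
\<close>

section \<open>Linear algebra over the exterior algebra\<close>

text \<open>
  The product of \<open>exterior n\<close> does not depend on \<open>n\<close> and is bilinear and associative on arbitrary
  coefficient functions; written as an operation on this type it needs no membership side
  conditions.  Functions are added pointwise.
\<close>

definition wedge :: "(nat set \<Rightarrow> 'k::field) \<Rightarrow> (nat set \<Rightarrow> 'k) \<Rightarrow> nat set \<Rightarrow> 'k" (infixr "\<diamond>" 70) where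
  "f \<diamond> g = (\<lambda>S. \<Sum>A\<in>Pow S. wedge_sign A (S - A) * f A * g (S - A))"

abbreviation ext :: "nat \<Rightarrow> (nat set \<Rightarrow> 'k::field) set" where
  "ext n \<equiv> carrier (exterior n)"

lemma exterior_ops:
  "f \<otimes>\<^bsub>exterior n\<^esub> g = f \<diamond> g" "f \<oplus>\<^bsub>exterior n\<^esub> g = f + g"
  "\<zero>\<^bsub>exterior n\<^esub> = 0" "\<one>\<^bsub>exterior n\<^esub> = emon {}"
  by (simp_all add: exterior_def wedge_def plus_fun_def zero_fun_def emon_def)

lemma ext_iff: "f \<in> ext n \<longleftrightarrow> (\<forall>S. f S \<noteq> 0 \<longrightarrow> S \<subseteq> {1..n})"
  by (simp add: exterior_def)

lemma ext_zero [simp]: "0 \<in> ext n"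
  by (simp add: ext_iff)

lemma ext_add: "f \<in> ext n \<Longrightarrow> g \<in> ext n \<Longrightarrow> f + g \<in> ext n"
  unfolding ext_iff plus_fun_apply by (metis add_0)

lemma ext_uminus: "f \<in> ext n \<Longrightarrow> - f \<in> ext n"
  by (simp add: ext_iff)

lemma ext_diff: "f \<in> ext n \<Longrightarrow> g \<in> ext n \<Longrightarrow> f - g \<in> ext n"
  using ext_add[OF _ ext_uminus, of f n g] by simp

lemma ext_wedge: "f \<in> ext n \<Longrightarrow> g \<in> ext n \<Longrightarrow> f \<diamond> g \<in> ext n"
  using exterior_mult_closed[of f n g] by (simp add: exterior_ops)

lemma wedge_assoc: "(f \<diamond> g) \<diamond> h = f \<diamond> g \<diamond> h"
  using exterior_mult_assoc[where f = f and g = g and h = h] by (simp add: exterior_ops)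

lemma wedge_one [simp]: "f \<in> ext n \<Longrightarrow> f \<diamond> emon {} = f"
  using exterior_mult_one[of f n] by (simp add: exterior_ops)

lemma one_wedge [simp]: "f \<in> ext n \<Longrightarrow> emon {} \<diamond> f = f"
  using exterior_one_mult[of f n] by (simp add: exterior_ops)

lemma wedge_add_left: "(f + g) \<diamond> h = f \<diamond> h + g \<diamond> h"
  by (simp add: wedge_def fun_eq_iff algebra_simps sum.distrib)

lemma wedge_add_right: "h \<diamond> (f + g) = h \<diamond> f + h \<diamond> g"
  by (simp add: wedge_def fun_eq_iff algebra_simps sum.distrib)

lemma wedge_zero [simp]: "0 \<diamond> f = 0" "f \<diamond> 0 = 0"
  by (simp_all add: wedge_def fun_eq_iff)

lemma wedge_uminus: "(- f) \<diamond> g = - (f \<diamond> g)" "f \<diamond> (- g) = - (f \<diamond> g)"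
  by (simp_all add: wedge_def fun_eq_iff sum_negf)

lemma wedge_diff_left: "(f - g) \<diamond> h = f \<diamond> h - g \<diamond> h"
  using wedge_add_left[of f "- g" h] by (simp add: wedge_uminus)

lemma wedge_diff_right: "h \<diamond> (f - g) = h \<diamond> f - h \<diamond> g"
  using wedge_add_right[of h f "- g"] by (simp add: wedge_uminus)

lemma wedge_nonzeroE:
  assumes "(f \<diamond> g) S \<noteq> 0"
  obtains A where "A \<subseteq> S" "f A \<noteq> 0" "g (S - A) \<noteq> 0"
  using assms exterior_mult_nonzeroE[where f = f and g = g and S = S] by (auto simp: exterior_ops)

lemma wedge_empty [simp]: "(f \<diamond> g) {} = f {} * g {}"
  by (simp add: wedge_def)

lemma wedge_emon:
  assumes "finite \<tau>" "finite S"
  shows "(f \<diamond> emon \<tau>) S = (if \<tau> \<subseteq> S then wedge_sign (S - \<tau>) \<tau> * f (S - \<tau>) else 0)"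
proof -
  have "(f \<diamond> emon \<tau>) S = (\<Sum>A\<in>Pow S. if A = S - \<tau> then (if \<tau> \<subseteq> S then wedge_sign (S - \<tau>) \<tau> * f (S - \<tau>) else 0) else 0)"
    unfolding wedge_def
  proof (rule sum.cong[OF refl], goal_cases)
    case (1 A)
    then have "S - A = \<tau> \<longleftrightarrow> A = S - \<tau> \<and> \<tau> \<subseteq> S" by auto
    moreover have "A = S - \<tau> \<Longrightarrow> \<tau> \<subseteq> S \<Longrightarrow> S - A = \<tau>" by auto
    ultimately show ?case by (auto simp: emon_def)
  qed
  also have "\<dots> = (if \<tau> \<subseteq> S then wedge_sign (S - \<tau>) \<tau> * f (S - \<tau>) else 0)"
    using assms by (subst sum.delta) auto
  finally show ?thesis .
qed

lemma wedge_sign_square: "wedge_sign A B * wedge_sign A B = (1::'k::field)"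
  unfolding wedge_sign_def by (simp flip: power_mult_distrib)

lemma emon_ext: "\<sigma> \<subseteq> {1..n} \<Longrightarrow> emon \<sigma> \<in> ext n"
  by (rule emon_carrier)

lemma ext_support_finite: "f \<in> ext n \<Longrightarrow> f S \<noteq> 0 \<Longrightarrow> finite S"
  by (meson ext_iff finite_atLeastAtMost finite_subset)

text \<open>
  An element all of whose monomials are divisible by \<open>e\<^sub>\<tau>\<close> is a multiple of \<open>e\<^sub>\<tau>\<close>: divide
  term by term and absorb the sign.
\<close>

lemma multiple_of_emon:
  fixes f :: "nat set \<Rightarrow> 'k::field"
  assumes "f \<in> ext n" "\<tau> \<subseteq> {1..n}" "\<And>S. f S \<noteq> 0 \<Longrightarrow> \<tau> \<subseteq> S"
  obtains h where "h \<in> ext n" "f = h \<diamond> emon \<tau>"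
proof
  define h :: "nat set \<Rightarrow> 'k" where
    "h = (\<lambda>S. if S \<inter> \<tau> = {} then wedge_sign S \<tau> * f (S \<union> \<tau>) else 0)"
  show h: "h \<in> ext n" using assms(1) by (auto simp: ext_iff h_def)
  have fin: "finite \<tau>" using assms(2) finite_subset by blast
  show "f = h \<diamond> emon \<tau>"
  proof
    fix S
    show "f S = (h \<diamond> emon \<tau>) S"
    proof (cases "finite S")
      case True
      then show ?thesis
        using assms(3)[of S] unfolding wedge_emon[OF fin True]
        by (auto simp: h_def Un_absorb2 wedge_sign_square simp flip: mult.assoc)
    next
      case False
      then show ?thesis
        using ext_support_finite[OF assms(1)] ext_support_finite[OF ext_wedge[OF h emon_ext[OF assms(2)]]]
        by metis
    qed
  qed
qed

text \<open>
  Elements of free modules.  All modules below are submodules of some \<open>free_mod n r\<close>.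
\<close>

type_synonym 'k vec = "nat \<Rightarrow> nat set \<Rightarrow> 'k"

definition smul :: "(nat set \<Rightarrow> 'k::field) \<Rightarrow> 'k vec \<Rightarrow> 'k vec" (infixr "\<triangleright>" 70) where
  "f \<triangleright> x = (\<lambda>k. f \<diamond> x k)"

lemma smul_apply [simp]: "(f \<triangleright> x) k = f \<diamond> x k"
  by (simp add: smul_def)

lemma smul_simps:
  "(f + g) \<triangleright> x = f \<triangleright> x + g \<triangleright> x" "f \<triangleright> (x + y) = f \<triangleright> x + f \<triangleright> y"
  "(f - g) \<triangleright> x = f \<triangleright> x - g \<triangleright> x" "f \<triangleright> (x - y) = f \<triangleright> x - f \<triangleright> y"
  "(- f) \<triangleright> x = - (f \<triangleright> x)" "f \<triangleright> (- x) = - (f \<triangleright> x)"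
  "(f \<diamond> g) \<triangleright> x = f \<triangleright> g \<triangleright> x"
  by (simp_all add: fun_eq_iff[where 'b = "nat set \<Rightarrow> 'k"] smul_def wedge_add_left wedge_add_right wedge_diff_left wedge_diff_right
      wedge_uminus wedge_assoc)

lemma smul_zero [simp]: "0 \<triangleright> x = 0" "f \<triangleright> 0 = 0"
  by (simp_all add: fun_eq_iff[where 'b = "nat set \<Rightarrow> 'k"])

lemma sum_apply: "(\<Sum>j\<in>A. F j) k = (\<Sum>j\<in>A. F j k)"
  by (induction A rule: infinite_finite_induct) simp_all

lemma smul_sum: "f \<triangleright> (\<Sum>j\<in>A. F j) = (\<Sum>j\<in>A. f \<triangleright> F j)"
  by (induction A rule: infinite_finite_induct) (simp_all only: sum.infinite sum.empty sum.insert smul_zero smul_simps not_False_eq_True)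

lemma free_mod_iff: "x \<in> free_mod n r \<longleftrightarrow> (\<forall>k. x k \<in> ext n) \<and> (\<forall>k\<ge>r. x k = 0)"
  unfolding free_mod_def exterior_ops mem_Collect_eq by (metis ext_zero not_le)

lemma free_mod_zero [simp]: "0 \<in> free_mod n r"
  by (simp add: free_mod_iff)

lemma free_mod_add: "x \<in> free_mod n r \<Longrightarrow> y \<in> free_mod n r \<Longrightarrow> x + y \<in> free_mod n r"
  by (simp add: free_mod_iff ext_add)

lemma free_mod_diff: "x \<in> free_mod n r \<Longrightarrow> y \<in> free_mod n r \<Longrightarrow> x - y \<in> free_mod n r"
  by (simp add: free_mod_iff ext_diff)

lemma free_mod_smul: "f \<in> ext n \<Longrightarrow> x \<in> free_mod n r \<Longrightarrow> f \<triangleright> x \<in> free_mod n r"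
  by (simp add: free_mod_iff ext_wedge)

lemma free_mod_sum: "(\<And>j. j \<in> A \<Longrightarrow> F j \<in> free_mod n r) \<Longrightarrow> (\<Sum>j\<in>A. F j) \<in> free_mod n r"
  by (induction A rule: infinite_finite_induct) (simp_all add: free_mod_add)

lemma free_mod_mono: "x \<in> free_mod n r \<Longrightarrow> r \<le> s \<Longrightarrow> x \<in> free_mod n s"
  by (simp add: free_mod_iff)

lemma free_mod_0 [simp]: "free_mod n 0 = {0}"
  by (auto simp: free_mod_iff)

definition comb :: "nat \<Rightarrow> (nat \<Rightarrow> 'k::field vec) \<Rightarrow> 'k vec \<Rightarrow> 'k vec" where
  "comb r A c = (\<Sum>j<r. c j \<triangleright> A j)"

lemma comb_closed:
  "c \<in> free_mod n r \<Longrightarrow> \<forall>j<r. A j \<in> free_mod n s \<Longrightarrow> comb r A c \<in> free_mod n s"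
  unfolding comb_def by (intro free_mod_sum free_mod_smul) (auto simp: free_mod_iff)

lemma comb_linear:
  "comb r A (x + y) = comb r A x + comb r A y" "comb r A (x - y) = comb r A x - comb r A y"
  "comb r A (f \<triangleright> x) = f \<triangleright> comb r A x" "comb r A 0 = 0"
  by (simp_all add: comb_def smul_simps sum.distrib sum_subtractf smul_sum)

definition basis_vec :: "nat \<Rightarrow> 'k::field vec" where
  "basis_vec j = (\<lambda>k. if k = j then emon {} else 0)"

lemma basis_vec_closed: "j < r \<Longrightarrow> basis_vec j \<in> free_mod n r"
  by (auto simp: free_mod_iff basis_vec_def emon_ext)

lemma smul_basis_vec: "f \<in> ext n \<Longrightarrow> f \<triangleright> basis_vec j = (\<lambda>k. if k = j then f else 0)"
  by (auto simp: basis_vec_def fun_eq_iff[where 'b = "nat set \<Rightarrow> 'k"])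

lemma comb_basis_vec:
  assumes "j < r" "A j \<in> free_mod n s"
  shows "comb r A (basis_vec j) = A j"
proof -
  have "comb r A (basis_vec j) = (\<Sum>i<r. if i = j then A j else 0)"
    unfolding comb_def
  proof (rule sum.cong[OF refl])
    fix i show "basis_vec j i \<triangleright> A i = (if i = j then A j else 0)"
      using assms(2) one_wedge[of "A j _" n]
      by (auto simp: basis_vec_def fun_eq_iff[where 'b = "nat set \<Rightarrow> 'a"] free_mod_iff)
  qed
  then show ?thesis using assms(1) by simp
qed

lemma comb_of_basis:
  assumes "x \<in> free_mod n r"
  shows "comb r basis_vec x = x"
proof
  fix k
  have "comb r basis_vec x k = (\<Sum>j<r. if k = j then x j else 0)"
    unfolding comb_def sum_apply[where k = k]
    using assms by (intro sum.cong refl) (auto simp: free_mod_iff smul_basis_vec[of _ n] simp del: smul_apply)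
  then show "comb r basis_vec x k = x k"
    using assms by (auto simp: free_mod_iff)
qed

lemma finsum_exterior:
  fixes F :: "'i \<Rightarrow> nat set \<Rightarrow> 'k::field"
  assumes "\<And>j. j \<in> A \<Longrightarrow> F j \<in> ext n" "finite A"
  shows "(\<Oplus>\<^bsub>exterior n\<^esub>j\<in>A. F j) = (\<Sum>j\<in>A. F j)"
proof -
  interpret ring "exterior n :: (nat set \<Rightarrow> 'k) ring" by (rule ring_exterior)
  from assms(2,1) show ?thesis
  proof (induction A rule: finite_induct)
    case (insert x A)
    have "(\<Oplus>\<^bsub>exterior n\<^esub>j\<in>insert x A. F j) = F x \<oplus>\<^bsub>exterior n\<^esub> (\<Oplus>\<^bsub>exterior n\<^esub>j\<in>A. F j)"
      using insert by (intro finsum_insert) auto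
    then show ?case using insert by (simp add: exterior_ops(2))
  qed (simp add: exterior_ops(3))
qed

lemma free_map_eq_comb:
  assumes "\<forall>j<r. A j \<in> free_mod n s" "c \<in> free_mod n r"
  shows "free_map n r A c = comb r A c"
proof
  fix k
  have "c j \<diamond> A j k \<in> ext n" if "j < r" for j
    using assms that by (intro ext_wedge) (auto simp: free_mod_iff)
  then have "(\<Oplus>\<^bsub>exterior n\<^esub>j\<in>{..<r}. c j \<diamond> A j k) = (\<Sum>j<r. c j \<diamond> A j k)"
    by (intro finsum_exterior) auto
  then show "free_map n r A c k = comb r A c k"
    by (simp add: free_map_def comb_def exterior_ops sum_apply)
qed

text \<open>
  Identifies \<open>E\<close> with \<open>E\<^sup>1\<close>, so that the augmentation and the differentials of a resolution can be
  treated alike.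
\<close>

definition embed_vec :: "(nat set \<Rightarrow> 'k::field) \<Rightarrow> 'k vec" where
  "embed_vec f = (\<lambda>k. if k = 0 then f else 0)"

lemma embed_vec_0 [simp]: "embed_vec f 0 = f" "embed_vec 0 = 0"
  by (auto simp: embed_vec_def)

lemma embed_vec_closed [simp]: "embed_vec f \<in> free_mod n 1 \<longleftrightarrow> f \<in> ext n"
  by (auto simp: embed_vec_def free_mod_iff)

lemma embed_vec_simps: "embed_vec (f + g) = embed_vec f + embed_vec g" "f \<triangleright> embed_vec g = embed_vec (f \<diamond> g)"
  "embed_vec (f - g) = embed_vec f - embed_vec g" "embed_vec f = embed_vec g \<longleftrightarrow> f = g"
  by (auto simp: embed_vec_def fun_eq_iff[where 'b = "nat set \<Rightarrow> 'a"] dest: meta_spec[of _ 0])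

lemma free_aug_eq_comb:
  assumes "\<forall>j<r. g j \<in> ext n" "c \<in> free_mod n r"
  shows "embed_vec (free_aug n r g c) = comb r (\<lambda>j. embed_vec (g j)) c"
proof
  fix k
  have "c j \<diamond> g j \<in> ext n" if "j < r" for j
    using assms that by (intro ext_wedge) (auto simp: free_mod_iff)
  then have "(\<Oplus>\<^bsub>exterior n\<^esub>j\<in>{..<r}. c j \<diamond> g j) = (\<Sum>j<r. c j \<diamond> g j)"
    by (intro finsum_exterior) auto
  then show "embed_vec (free_aug n r g c) k = comb r (\<lambda>j. embed_vec (g j)) c k"
    by (auto simp: embed_vec_def free_aug_def comb_def exterior_ops sum_apply)
qed

section \<open>Syzygies of modules with linear quotients\<close>

text \<open>
  The ideal \<open>(e\<^sub>1,\<dots>,e\<^sub>m)\<close>, described by the supports of its elements.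
\<close>

definition var_ideal :: "nat \<Rightarrow> nat \<Rightarrow> (nat set \<Rightarrow> 'k::field) set" where
  "var_ideal n m = {f \<in> ext n. \<forall>S. f S \<noteq> 0 \<longrightarrow> S \<inter> {1..m} \<noteq> {}}"

lemma var_ideal_0 [simp]: "var_ideal n 0 = {0}"
  by (auto simp: var_ideal_def fun_eq_iff)

lemma var_ideal_add: "f \<in> var_ideal n m \<Longrightarrow> g \<in> var_ideal n m \<Longrightarrow> f + g \<in> var_ideal n m"
  by (simp add: var_ideal_def ext_add) (metis add.right_neutral)

lemma var_ideal_wedge: "f \<in> ext n \<Longrightarrow> g \<in> var_ideal n m \<Longrightarrow> f \<diamond> g \<in> var_ideal n m"
  unfolding var_ideal_def mem_Collect_eq
  by (blast intro: ext_wedge elim: wedge_nonzeroE)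

text \<open>
  The part of \<open>f\<close> whose monomials contain \<open>e\<^bsub>l+1\<^esub>\<close> is a multiple of \<open>e\<^bsub>l+1\<^esub>\<close>.
\<close>

lemma var_ideal_Suc:
  assumes "f \<in> ext n" "Suc l \<le> n"
  shows "f \<in> var_ideal n (Suc l) \<longleftrightarrow> (\<exists>h\<in>ext n. f - h \<diamond> emon {Suc l} \<in> var_ideal n l)"
proof
  assume f: "f \<in> var_ideal n (Suc l)"
  define g where "g = (\<lambda>S. if Suc l \<in> S then f S else 0)"
  have "g \<in> ext n" using assms(1) by (simp add: ext_iff g_def)
  then obtain h where h: "h \<in> ext n" "g = h \<diamond> emon {Suc l}"
  proof (rule multiple_of_emon[of g n "{Suc l}"])
    show "{Suc l} \<subseteq> {1..n}" using assms(2) by auto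
    show "{Suc l} \<subseteq> S" if "g S \<noteq> 0" for S using that by (auto simp: g_def split: if_splits)
  qed
  have "f - g \<in> var_ideal n l"
    using f \<open>g \<in> ext n\<close> by (auto simp: var_ideal_def ext_diff g_def atLeastAtMostSuc_conv)
  then show "\<exists>h\<in>ext n. f - h \<diamond> emon {Suc l} \<in> var_ideal n l"
    using h by auto
next
  assume "\<exists>h\<in>ext n. f - h \<diamond> emon {Suc l} \<in> var_ideal n l"
  then obtain h where h: "h \<in> ext n" "f - h \<diamond> emon {Suc l} \<in> var_ideal n l" by blast
  have "emon {Suc l} \<in> var_ideal n (Suc l)"
    using assms(2) by (auto simp: var_ideal_def emon_ext) (auto simp: emon_def split: if_splits)
  then have "h \<diamond> emon {Suc l} \<in> var_ideal n (Suc l)" using h(1) by (intro var_ideal_wedge)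
  moreover have "f - h \<diamond> emon {Suc l} \<in> var_ideal n (Suc l)"
    using h(2) by (fastforce simp: var_ideal_def)
  ultimately show "f \<in> var_ideal n (Suc l)" using var_ideal_add by fastforce
qed

text \<open>
  The colon ideal \<open>(e\<^sub>1,\<dots>,e\<^sub>l) : e\<^bsub>l+1\<^esub>\<close> contains \<open>e\<^bsub>l+1\<^esub>\<close> itself, as squares of variables vanish.
  This is where the exterior algebra differs from the polynomial ring, and why resolutions over it
  do not terminate.
\<close>

lemma wedge_emon_var_iff:
  assumes "f \<in> ext n" "Suc l \<le> n"
  shows "f \<diamond> emon {Suc l} \<in> var_ideal n l \<longleftrightarrow> f \<in> var_ideal n (Suc l)"
proof
  assume f: "f \<diamond> emon {Suc l} \<in> var_ideal n l"
  have "S \<inter> {1..Suc l} \<noteq> {}" if S: "f S \<noteq> 0" for S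
  proof (cases "Suc l \<in> S")
    case False
    have "finite S" using assms(1) S by (rule ext_support_finite)
    moreover have "insert (Suc l) S - {Suc l} = S" using False by auto
    ultimately have "(f \<diamond> emon {Suc l}) (insert (Suc l) S) = wedge_sign S {Suc l} * f S"
      by (subst wedge_emon) auto
    moreover have "wedge_sign S {Suc l} \<noteq> (0::'a)"
      using wedge_sign_square[of S "{Suc l}", where 'k = 'a] by auto
    ultimately have "insert (Suc l) S \<inter> {1..l} \<noteq> {}"
      using f S unfolding var_ideal_def mem_Collect_eq by (metis mult_eq_0_iff)
    then show ?thesis by auto
  qed auto
  then show "f \<in> var_ideal n (Suc l)" using assms(1) by (simp add: var_ideal_def)
next
  assume f: "f \<in> var_ideal n (Suc l)"
  have "S \<inter> {1..l} \<noteq> {}" if S: "(f \<diamond> emon {Suc l}) S \<noteq> 0" for S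
  proof -
    obtain A where A: "A \<subseteq> S" "f A \<noteq> 0" "emon {Suc l} (S - A) \<noteq> (0::'a)"
      using S by (rule wedge_nonzeroE)
    then have "S - A = {Suc l}" by (auto simp: emon_def split: if_splits)
    moreover have "A \<inter> {1..Suc l} \<noteq> {}" using f A(2) by (auto simp: var_ideal_def)
    ultimately show ?thesis using A(1) by (auto simp: atLeastAtMostSuc_conv)
  qed
  then show "f \<diamond> emon {Suc l} \<in> var_ideal n l"
    using assms by (auto simp: var_ideal_def intro!: ext_wedge emon_ext)
qed

definition gen :: "nat \<Rightarrow> 'k::field vec list \<Rightarrow> 'k vec set" where
  "gen n xs = comb (length xs) ((!) xs) ` free_mod n (length xs)"

definition syz :: "nat \<Rightarrow> 'k::field vec list \<Rightarrow> 'k vec set" where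
  "syz n xs = {z \<in> free_mod n (length xs). comb (length xs) ((!) xs) z = 0}"

lemma gen_Nil [simp]: "gen n [] = {0}"
  by (simp add: gen_def comb_linear)

lemma syz_Nil [simp]: "syz n [] = {0}"
  by (auto simp: syz_def comb_linear)

lemma gen_uminus:
  assumes "x \<in> gen n xs"
  shows "- x \<in> gen n xs"
proof -
  obtain c where c: "c \<in> free_mod n (length xs)" "x = comb (length xs) ((!) xs) c"
    using assms by (auto simp: gen_def)
  then have "- x = comb (length xs) ((!) xs) (0 - c)" by (simp only: comb_linear) simp
  then show ?thesis unfolding gen_def using c(1) free_mod_diff[OF free_mod_zero] by blast
qed

lemma comb_cong_upto:
  "(\<And>j. j < r \<Longrightarrow> A j = B j) \<Longrightarrow> (\<And>j. j < r \<Longrightarrow> c j = c' j) \<Longrightarrow> comb r A c = comb r B c'"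
  by (simp add: comb_def)

lemma comb_snoc:
  "comb (length (xs @ [x])) ((!) (xs @ [x])) c = comb (length xs) ((!) xs) c + c (length xs) \<triangleright> x"
  by (simp add: comb_def nth_append)

lemma free_mod_restrict:
  "c \<in> free_mod n (Suc r) \<Longrightarrow> c(r := 0) \<in> free_mod n r"
  by (auto simp: free_mod_iff)

lemma free_mod_extend:
  "c \<in> free_mod n r \<Longrightarrow> f \<in> ext n \<Longrightarrow> c(r := f) \<in> free_mod n (Suc r)"
  by (auto simp: free_mod_iff)

lemma gen_snoc_iff: "y \<in> gen n (xs @ [x]) \<longleftrightarrow> (\<exists>f\<in>ext n. y - f \<triangleright> x \<in> gen n xs)"
proof
  let ?p = "length xs"
  assume "y \<in> gen n (xs @ [x])"
  then obtain c where c: "c \<in> free_mod n (Suc ?p)" "y = comb ?p ((!) xs) c + c ?p \<triangleright> x"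
    unfolding gen_def comb_snoc by auto
  have "comb ?p ((!) xs) c = comb ?p ((!) xs) (c(?p := 0))" by (rule comb_cong_upto) auto
  then have "y - c ?p \<triangleright> x \<in> gen n xs" using c free_mod_restrict unfolding gen_def by auto
  then show "\<exists>f\<in>ext n. y - f \<triangleright> x \<in> gen n xs" using c(1) by (auto simp: free_mod_iff)
next
  let ?p = "length xs"
  assume "\<exists>f\<in>ext n. y - f \<triangleright> x \<in> gen n xs"
  then obtain f c where c: "f \<in> ext n" "c \<in> free_mod n ?p" "y - f \<triangleright> x = comb ?p ((!) xs) c"
    by (auto simp: gen_def)
  have "comb ?p ((!) xs) (c(?p := f)) = comb ?p ((!) xs) c" by (rule comb_cong_upto) auto
  then have "y = comb (length (xs @ [x])) ((!) (xs @ [x])) (c(?p := f))"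
    unfolding comb_snoc using c(3) by (simp add: algebra_simps)
  then show "y \<in> gen n (xs @ [x])"
    unfolding gen_def using free_mod_extend[OF c(2,1)] by auto
qed

definition homog :: "nat \<Rightarrow> (nat set \<Rightarrow> 'k::field) \<Rightarrow> bool" where
  "homog c f \<longleftrightarrow> (\<forall>S. f S \<noteq> 0 \<longrightarrow> card S = c)"

lemma homog_homogeneous: "homog c f \<Longrightarrow> homogeneous (int c) f"
  by (simp add: homog_def homogeneous_def)

lemma homog_emon: "homog (card \<sigma>) (emon \<sigma>)"
  by (simp add: homog_def emon_def)

lemma homog_wedge:
  assumes "homog a f" "homog b g" "f \<in> ext n"
  shows "homog (a + b) (f \<diamond> g)"
  unfolding homog_def
proof (intro allI impI)
  fix S assume "(f \<diamond> g) S \<noteq> 0"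
  then obtain A where A: "A \<subseteq> S" "f A \<noteq> 0" "g (S - A) \<noteq> 0" by (rule wedge_nonzeroE)
  moreover have "finite S"
    using \<open>(f \<diamond> g) S \<noteq> 0\<close> unfolding wedge_def by (meson finite_Pow_iff sum.infinite)
  ultimately have "card S = card A + card (S - A)"
    using card_Un_disjoint[of A "S - A"] by (auto simp: Un_absorb1 dest: finite_subset)
  then show "card S = a + b" using assms A by (simp add: homog_def)
qed

definition component :: "nat \<Rightarrow> (nat set \<Rightarrow> 'k::field) \<Rightarrow> nat set \<Rightarrow> 'k" where
  "component a f = (\<lambda>S. if card S = a then f S else 0)"

lemma component_ext: "f \<in> ext n \<Longrightarrow> component a f \<in> ext n"
  by (simp add: ext_iff component_def)

lemma homog_component: "homog a (component a f)"
  by (simp add: homog_def component_def)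

lemma component_homog: "homog a f \<Longrightarrow> component a f = f"
  by (auto simp: homog_def component_def fun_eq_iff)

lemma component_zero [simp]: "component a 0 = 0"
  by (simp add: component_def fun_eq_iff)

lemma component_sum: "component a (\<Sum>j\<in>A. F j) = (\<Sum>j\<in>A. component a (F j))"
  by (auto simp: component_def sum_apply fun_eq_iff)

lemma component_wedge:
  assumes "homog b g"
  shows "component (a + b) (f \<diamond> g) = component a f \<diamond> g"
proof
  fix S
  show "component (a + b) (f \<diamond> g) S = (component a f \<diamond> g) S"
  proof (cases "finite S")
    case True
    have "card A = a \<longleftrightarrow> card S = a + b" if "A \<subseteq> S" "g (S - A) \<noteq> 0" for A
    proof -
      have "card (S - A) = b" using assms that(2) by (simp add: homog_def)
      moreover have "card (S - A) = card S - card A" "card A \<le> card S"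
        using that(1) True by (auto simp: card_Diff_subset finite_subset card_mono)
      ultimately show ?thesis by linarith
    qed
    then have "(component a f \<diamond> g) S =
        (\<Sum>A\<in>Pow S. if card S = a + b then wedge_sign A (S - A) * f A * g (S - A) else 0)"
      unfolding wedge_def component_def by (intro sum.cong) auto
    then show ?thesis by (simp add: component_def wedge_def)
  qed (simp add: component_def wedge_def)
qed

text \<open>
  In a relation with homogeneous left-hand side and homogeneous vectors, the coefficients may be
  replaced by their components of the expected degree.
\<close>

lemma comb_component:
  assumes "\<forall>k. homog (a + b) (y k)" "\<forall>j<r. \<forall>k. homog b (A j k)" "y = comb r A c"
  shows "y = comb r A (\<lambda>j. component a (c j))"
proof
  fix k
  have "y k = component (a + b) (comb r A c k)"
    using assms by (simp add: component_homog)
  also have "\<dots> = comb r A (\<lambda>j. component a (c j)) k"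
    using assms(2) by (simp add: comb_def sum_apply component_sum component_wedge)
  finally show "y k = comb r A (\<lambda>j. component a (c j)) k" .
qed

text \<open>
  The list \<open>xs\<close> of vectors of \<open>E\<^sup>r\<close>, all with entries of degree \<open>c\<close>, has linear quotients with bounds
  \<open>ms\<close>: the coefficients that multiply a vector \<open>x\<close> of the list into the span of the vectors before
  \<open>x\<close> are those in \<open>(e\<^sub>1,\<dots>,e\<^sub>m)\<close>, for the bound \<open>m\<close> at the position of \<open>x\<close>.
\<close>

inductive linear_quotients :: "nat \<Rightarrow> nat \<Rightarrow> nat \<Rightarrow> 'k::field vec list \<Rightarrow> nat list \<Rightarrow> bool"
  for n r c where
  Nil: "linear_quotients n r c [] []"
| snoc: "\<lbrakk>linear_quotients n r c xs ms; x \<in> free_mod n r; \<forall>k. homog c (x k); m \<le> n;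
    \<forall>f\<in>ext n. f \<triangleright> x \<in> gen n xs \<longleftrightarrow> f \<in> var_ideal n m\<rbrakk>
   \<Longrightarrow> linear_quotients n r c (xs @ [x]) (ms @ [m])"

lemma linear_quotients_length: "linear_quotients n r c xs ms \<Longrightarrow> length xs = length ms"
  by (induction rule: linear_quotients.induct) auto

lemma linear_quotients_elem:
  "linear_quotients n r c xs ms \<Longrightarrow> x \<in> set xs \<Longrightarrow> x \<in> free_mod n r \<and> (\<forall>k. homog c (x k))"
  by (induction rule: linear_quotients.induct) auto

lemma linear_quotients_mono:
  "linear_quotients n r c xs ms \<Longrightarrow> r \<le> s \<Longrightarrow> linear_quotients n s c xs ms"
  by (induction rule: linear_quotients.induct)
    (auto intro: linear_quotients.intros free_mod_mono)

text \<open>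
  The bounds of the syzygies of a list with bounds \<open>ms\<close>.
\<close>

definition split_bounds :: "nat list \<Rightarrow> nat list" where
  "split_bounds ms = concat (map (\<lambda>m. [1..<Suc m]) ms)"

lemma syz_snoc_iff:
  "z \<in> syz n (xs @ [x]) \<longleftrightarrow> z \<in> free_mod n (Suc (length xs)) \<and>
     comb (length xs) ((!) xs) z + z (length xs) \<triangleright> x = 0"
  unfolding syz_def comb_snoc by simp

lemma syz_snoc_zero: "{z \<in> syz n (xs @ [x]). z (length xs) = 0} = syz n xs"
proof -
  have "z \<in> free_mod n (length xs) \<longleftrightarrow> z \<in> free_mod n (Suc (length xs)) \<and> z (length xs) = 0" for z :: "'a vec"
    unfolding free_mod_iff by (metis Suc_leD le_antisym not_less_eq_eq order_refl)
  then show ?thesis unfolding syz_snoc_iff by (auto simp: syz_def)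
qed

lemma syz_snoc_leading:
  assumes "\<forall>f\<in>ext n. f \<triangleright> x \<in> gen n xs \<longleftrightarrow> f \<in> var_ideal n m" "z \<in> syz n (xs @ [x])"
  shows "z (length xs) \<in> var_ideal n m"
proof -
  let ?p = "length xs"
  have z: "z \<in> free_mod n (Suc ?p)" "comb ?p ((!) xs) z + z ?p \<triangleright> x = 0"
    using assms(2) by (simp_all add: syz_snoc_iff)
  have "comb ?p ((!) xs) z = comb ?p ((!) xs) (z(?p := 0))" by (rule comb_cong_upto) auto
  then have "comb ?p ((!) xs) z \<in> gen n xs" using free_mod_restrict[OF z(1)] by (simp add: gen_def)
  moreover have "z ?p \<triangleright> x = - comb ?p ((!) xs) z" using z(2) by (simp add: eq_neg_iff_add_eq_0 add.commute)
  ultimately have "z ?p \<triangleright> x \<in> gen n xs" by (simp add: gen_uminus)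
  moreover have "z ?p \<in> ext n" using z(1) by (simp add: free_mod_iff)
  ultimately show ?thesis using assms(1) by blast
qed

lemma syz_diff_smul:
  assumes "w \<in> syz n xs" "f \<in> ext n"
  shows "z - f \<triangleright> w \<in> syz n xs \<longleftrightarrow> z \<in> syz n xs"
proof -
  have "f \<triangleright> w \<in> syz n xs" using assms by (simp add: syz_def free_mod_smul comb_linear)
  then show ?thesis
    using free_mod_add[of "z - f \<triangleright> w" n "length xs" "f \<triangleright> w"]
    by (auto simp: syz_def comb_linear free_mod_diff)
qed

text \<open>
  One more generator \<open>x\<close>, with bound \<open>m\<close>, adds for each \<open>l \<le> m\<close> the syzygy that
  expresses \<open>e\<^sub>l \<and> x\<close> through the earlier generators.  Adding them one at a time exhausts the
  filtration of the syzygies by the condition that the last coordinate lies in \<open>(e\<^sub>1,\<dots>,e\<^sub>l)\<close>; the colon ideals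
  can be read off the last coordinate alone.
\<close>

lemma linear_quotients_syzygies_snoc:
  fixes xs :: "'k::field vec list"
  assumes lq: "linear_quotients n r c xs ms" "\<forall>k. homog c (x k)" "m \<le> n"
    "\<forall>f\<in>ext n. f \<triangleright> x \<in> gen n xs \<longleftrightarrow> f \<in> var_ideal n m"
    and zs: "linear_quotients n (length xs) 1 zs ls" "gen n zs = syz n xs"
    and "l \<le> m"
  shows "\<exists>ws. linear_quotients n (Suc (length xs)) 1 (zs @ ws) (ls @ [1..<Suc l]) \<and>
    gen n (zs @ ws) = {z \<in> syz n (xs @ [x]). z (length xs) \<in> var_ideal n l}"
  using \<open>l \<le> m\<close>
proof (induction l)
  case 0
  show ?case
    using linear_quotients_mono[OF zs(1)] syz_snoc_zero[of n xs x] zs(2)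
    by (intro exI[of _ "[]"]) auto
next
  case (Suc l)
  let ?p = "length xs"
  let ?e = "emon {Suc l} :: nat set \<Rightarrow> 'k"
  obtain ws where ws: "linear_quotients n (Suc ?p) 1 (zs @ ws) (ls @ [1..<Suc l])"
    "gen n (zs @ ws) = {z \<in> syz n (xs @ [x]). z ?p \<in> var_ideal n l}"
    using Suc by auto
  have le: "Suc l \<le> n" using Suc.prems lq(3) by simp
  have e: "?e \<in> ext n" using le by (intro emon_ext) auto
  have "?e \<in> var_ideal n m"
    using e Suc.prems by (auto simp: var_ideal_def) (auto simp: emon_def split: if_splits)
  then obtain b where b: "b \<in> free_mod n ?p" "?e \<triangleright> x = comb ?p ((!) xs) b"
    using lq(4) e by (auto simp: gen_def)
  have "\<forall>k. homog (1 + c) ((?e \<triangleright> x) k)"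
    using homog_wedge[OF homog_emon _ e] lq(2) by (metis card_1_singleton_iff One_nat_def smul_apply)
  then have b1: "?e \<triangleright> x = comb ?p ((!) xs) (\<lambda>j. component 1 (b j))"
    using linear_quotients_elem[OF lq(1)] b(2) by (intro comb_component) auto
  \<comment> \<open>The new syzygy; only the linear components of the coefficients are kept, to make it homogeneous.\<close>
  define w where "w = (\<lambda>j. if j = ?p then ?e else - component 1 (b j))"
  have w_free: "w \<in> free_mod n (Suc ?p)"
    using b(1) e by (auto simp: w_def free_mod_iff component_ext ext_uminus)
  have w_homog: "\<forall>k. homog 1 (w k)"
    using homog_emon[of "{Suc l}"] homog_component[of 1] by (auto simp: w_def homog_def)
  have "comb ?p ((!) xs) w = comb ?p ((!) xs) (0 - (\<lambda>j. component 1 (b j)))"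
    by (rule comb_cong_upto) (auto simp: w_def)
  then have w_syz: "w \<in> syz n (xs @ [x])"
    unfolding syz_snoc_iff using w_free b1 by (simp only: comb_linear) (simp add: w_def)
  have w_top: "w ?p = ?e" by (simp add: w_def)
  have step: "z - f \<triangleright> w \<in> gen n (zs @ ws) \<longleftrightarrow>
      z \<in> syz n (xs @ [x]) \<and> z ?p - f \<diamond> ?e \<in> var_ideal n l" if "f \<in> ext n" for z f
    unfolding ws(2) using syz_diff_smul[OF w_syz that] by (simp add: w_top)
  have syz_0: "0 \<in> syz n (xs @ [x])" by (simp add: syz_def comb_linear)
  have colon: "f \<triangleright> w \<in> gen n (zs @ ws) \<longleftrightarrow> f \<in> var_ideal n (Suc l)" if "f \<in> ext n" for f
    using step[OF ext_uminus[OF that], of 0] wedge_emon_var_iff[OF that le] syz_0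
    by (simp add: smul_simps wedge_uminus)
  have "gen n (zs @ ws @ [w]) = {z \<in> syz n (xs @ [x]). z ?p \<in> var_ideal n (Suc l)}" (is "?L = ?R")
  proof (rule Set.set_eqI)
    fix z
    have "z \<in> ?L \<longleftrightarrow> z \<in> syz n (xs @ [x]) \<and> (\<exists>f\<in>ext n. z ?p - f \<diamond> ?e \<in> var_ideal n l)"
      using gen_snoc_iff[of z n "zs @ ws" w] step by auto
    also have "\<dots> \<longleftrightarrow> z \<in> ?R"
      using var_ideal_Suc[OF _ le, of "z ?p"] by (auto simp: syz_def free_mod_iff)
    finally show "z \<in> ?L \<longleftrightarrow> z \<in> ?R" .
  qed
  moreover have "linear_quotients n (Suc ?p) 1 ((zs @ ws) @ [w]) ((ls @ [1..<Suc l]) @ [Suc l])"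
    using ws(1) w_free w_homog le colon by (intro linear_quotients.snoc) auto
  ultimately show ?case by (intro exI[of _ "ws @ [w]"]) simp
qed

text \<open>
  At \<open>l = m\<close> the filtration is exhausted, since the last coordinate of any syzygy multiplies the last
  generator into the span of the earlier ones.
\<close>

lemma linear_quotients_syzygies:
  assumes "linear_quotients n r c xs ms"
  shows "\<exists>zs. linear_quotients n (length xs) 1 zs (split_bounds ms) \<and> gen n zs = syz n xs"
  using assms
proof (induction rule: linear_quotients.induct)
  case Nil
  show ?case by (rule exI[of _ "[]"]) (simp add: split_bounds_def linear_quotients.Nil)
next
  case (snoc xs ms x m)
  then obtain zs where zs: "linear_quotients n (length xs) 1 zs (split_bounds ms)" "gen n zs = syz n xs"
    by blast
  obtain ws where "linear_quotients n (Suc (length xs)) 1 (zs @ ws) (split_bounds ms @ [1..<Suc m])"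
    "gen n (zs @ ws) = {z \<in> syz n (xs @ [x]). z (length xs) \<in> var_ideal n m}"
    using linear_quotients_syzygies_snoc[OF snoc(1,3,4,5) zs order_refl] by blast
  moreover have "{z \<in> syz n (xs @ [x]). z (length xs) \<in> var_ideal n m} = syz n (xs @ [x])"
    using syz_snoc_leading[OF snoc(5)] by blast
  ultimately show ?case by (intro exI[of _ "zs @ ws"]) (simp add: split_bounds_def)
qed

section \<open>Uniqueness of minimal resolutions\<close>

definition ext_linear :: "nat \<Rightarrow> 'k::field vec set \<Rightarrow> ('k vec \<Rightarrow> 'k vec) \<Rightarrow> bool" where
  "ext_linear n M \<phi> \<longleftrightarrow> (\<forall>x\<in>M. \<forall>y\<in>M. \<phi> (x + y) = \<phi> x + \<phi> y) \<and>
     (\<forall>f\<in>ext n. \<forall>x\<in>M. \<phi> (f \<triangleright> x) = f \<triangleright> \<phi> x)"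

definition submodule :: "nat \<Rightarrow> 'k::field vec set \<Rightarrow> bool" where
  "submodule n M \<longleftrightarrow> 0 \<in> M \<and> (\<forall>x\<in>M. \<forall>y\<in>M. x + y \<in> M) \<and> (\<forall>f\<in>ext n. \<forall>x\<in>M. f \<triangleright> x \<in> M)"

lemma ext_linear_zero: "ext_linear n M \<phi> \<Longrightarrow> 0 \<in> M \<Longrightarrow> \<phi> 0 = 0"
  unfolding ext_linear_def by (metis ext_zero smul_zero(1))

lemma ext_linear_comb:
  assumes "ext_linear n M \<phi>" "submodule n M" "c \<in> free_mod n r" "\<forall>j<r. A j \<in> M"
  shows "comb r A c \<in> M \<and> \<phi> (comb r A c) = comb r (\<lambda>j. \<phi> (A j)) c"
proof -
  have "(\<Sum>j<s. c j \<triangleright> A j) \<in> M \<and> \<phi> (\<Sum>j<s. c j \<triangleright> A j) = (\<Sum>j<s. c j \<triangleright> \<phi> (A j))" if "s \<le> r" for s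
    using that
  proof (induction s)
    case 0
    then show ?case using ext_linear_zero[OF assms(1)] assms(2)
      unfolding submodule_def lessThan_0 sum.empty by blast
  next
    case (Suc s)
    have "c s \<in> ext n" using assms(3) by (simp add: free_mod_iff)
    then have *: "c s \<triangleright> A s \<in> M" "\<phi> (c s \<triangleright> A s) = c s \<triangleright> \<phi> (A s)"
      using Suc.prems assms by (auto simp only: submodule_def ext_linear_def Suc_le_eq)
    have IH: "(\<Sum>j<s. c j \<triangleright> A j) \<in> M" "\<phi> (\<Sum>j<s. c j \<triangleright> A j) = (\<Sum>j<s. c j \<triangleright> \<phi> (A j))"
      using Suc.IH Suc.prems Suc_leD by blast+
    have "(\<Sum>j<s. c j \<triangleright> A j) + c s \<triangleright> A s \<in> M"
      using assms(2) * IH unfolding submodule_def by blast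
    moreover have "\<phi> ((\<Sum>j<s. c j \<triangleright> A j) + c s \<triangleright> A s) = \<phi> (\<Sum>j<s. c j \<triangleright> A j) + \<phi> (c s \<triangleright> A s)"
      using assms(1) * IH unfolding ext_linear_def by blast
    ultimately show ?case unfolding sum.lessThan_Suc using *(2) IH(2) by (simp only:)
  qed
  then show ?thesis by (simp add: comb_def)
qed

lemma ext_linear_inverse:
  fixes \<phi> :: "'k::field vec \<Rightarrow> 'k vec"
  assumes "ext_linear n M \<phi>" "submodule n M" "bij_betw \<phi> M M'"
  shows "ext_linear n M' (inv_into M \<phi>)"
  unfolding ext_linear_def
proof (intro conjI ballI)
  have inj: "inj_on \<phi> M" and im: "\<phi> ` M = M'" using assms(3) by (auto simp: bij_betw_def)
  have inv: "inv_into M \<phi> x \<in> M" "\<phi> (inv_into M \<phi> x) = x" if "x \<in> M'" for x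
    using that im inv_into_into[of x \<phi> M] f_inv_into_f[of x \<phi> M] by simp_all
  fix x y assume xy: "x \<in> M'" "y \<in> M'"
  have "\<phi> (inv_into M \<phi> x + inv_into M \<phi> y) = x + y"
    using assms(1) inv xy by (simp add: ext_linear_def)
  moreover have "inv_into M \<phi> x + inv_into M \<phi> y \<in> M"
    using assms(2) inv xy by (simp add: submodule_def)
  ultimately show "inv_into M \<phi> (x + y) = inv_into M \<phi> x + inv_into M \<phi> y"
    by (intro inv_into_f_eq[OF inj])
next
  have inj: "inj_on \<phi> M" and im: "\<phi> ` M = M'" using assms(3) by (auto simp: bij_betw_def)
  have inv: "inv_into M \<phi> x \<in> M" "\<phi> (inv_into M \<phi> x) = x" if "x \<in> M'" for x
    using that im inv_into_into[of x \<phi> M] f_inv_into_f[of x \<phi> M] by simp_all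
  fix f :: "nat set \<Rightarrow> 'k" and x assume f: "f \<in> ext n" and x: "x \<in> M'"
  have "\<phi> (f \<triangleright> inv_into M \<phi> x) = f \<triangleright> x"
    using assms(1) inv x f by (simp add: ext_linear_def)
  moreover have "f \<triangleright> inv_into M \<phi> x \<in> M"
    using assms(2) inv x f by (simp add: submodule_def)
  ultimately show "inv_into M \<phi> (f \<triangleright> x) = f \<triangleright> inv_into M \<phi> x"
    by (intro inv_into_f_eq[OF inj])
qed

lemma submodule_free_mod: "submodule n (free_mod n r)"
  by (simp add: submodule_def free_mod_add free_mod_smul)

lemma ext_linear_combI: "ext_linear n (free_mod n r) (comb r A)"
  by (simp add: ext_linear_def comb_linear)

lemma submodule_image_comb: "submodule n (comb r A ` free_mod n r)"
  unfolding submodule_def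
proof (intro conjI ballI)
  show "0 \<in> comb r A ` free_mod n r"
    by (rule image_eqI[OF _ free_mod_zero]) (rule comb_linear(4)[symmetric])
next
  fix x y assume "x \<in> comb r A ` free_mod n r" "y \<in> comb r A ` free_mod n r"
  then obtain c c' where "c \<in> free_mod n r" "c' \<in> free_mod n r" "x = comb r A c" "y = comb r A c'"
    by blast
  then have "x + y = comb r A (c + c')" "c + c' \<in> free_mod n r"
    by (simp_all only: comb_linear free_mod_add)
  then show "x + y \<in> comb r A ` free_mod n r" by (rule image_eqI)
next
  fix f :: "nat set \<Rightarrow> 'a" and x assume f: "f \<in> ext n" and "x \<in> comb r A ` free_mod n r"
  then obtain c where "c \<in> free_mod n r" "x = comb r A c" by blast
  then have "f \<triangleright> x = comb r A (f \<triangleright> c)" "f \<triangleright> c \<in> free_mod n r"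
    using f by (simp_all only: comb_linear free_mod_smul)
  then show "f \<triangleright> x \<in> comb r A ` free_mod n r" by (rule image_eqI)
qed

text \<open>
  A \<open>p \<times> q\<close> matrix with a right inverse has independent rows.
\<close>

lemma scalar_matrix_inverse_le:
  fixes a c :: "nat \<Rightarrow> nat \<Rightarrow> 'k::field"
  assumes "\<And>i j. i < p \<Longrightarrow> j < p \<Longrightarrow> (\<Sum>k<q. a i k * c k j) = (if i = j then 1 else 0)"
  shows "p \<le> q"
proof -
  interpret V: vector_space "\<lambda>(s::'k) (x::nat \<Rightarrow> 'k) k. s * x k"
    by standard (auto simp: fun_eq_iff algebra_simps)
  define row where "row i = (\<lambda>k. if k < q then a i k else 0)" for i
  define T :: "(nat \<Rightarrow> 'k) set" where "T = (\<lambda>k j. if j = k then 1 else 0) ` {..<q}"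
  define L where "L j x = (\<Sum>k<q. x k * c k j)" for j x
  have L_row: "L j (row i) = (if i = j then 1 else 0)" if "i < p" "j < p" for i j
    using assms[OF that] by (simp add: L_def row_def)
  have inj: "inj_on row {..<p}"
  proof (rule inj_onI)
    fix i j assume ij: "i \<in> {..<p}" "j \<in> {..<p}" and eq: "row i = row j"
    have "L i (row i) = 1" "L i (row j) = (if j = i then 1 else 0)" using L_row ij by simp_all
    then show "i = j" unfolding eq by (metis zero_neq_one)
  qed
  have "V.independent (row ` {..<p})"
  proof
    assume "V.dependent (row ` {..<p})"
    then obtain u where u: "\<exists>v\<in>row ` {..<p}. u v \<noteq> 0" "(\<Sum>v\<in>row ` {..<p}. (\<lambda>k. u v * v k)) = 0"
      by (subst (asm) V.dependent_finite) auto
    have "u (row j) = 0" if "j < p" for j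
    proof -
      have "u (row j) = (\<Sum>i<p. if i = j then u (row i) else 0)" using that by simp
      also have "\<dots> = (\<Sum>i<p. u (row i) * L j (row i))"
        using L_row that by (intro sum.cong) auto
      also have "\<dots> = L j (\<Sum>i<p. (\<lambda>k. u (row i) * row i k))"
        unfolding L_def sum_apply sum_distrib_left sum_distrib_right
        by (subst sum.swap) (simp add: mult_ac)
      also have "(\<Sum>i<p. (\<lambda>k. u (row i) * row i k)) = 0"
        using u(2) by (simp add: sum.reindex[OF inj])
      finally show ?thesis by (simp add: L_def)
    qed
    then show False using u(1) by auto
  qed
  moreover have "row i \<in> V.span T" for i
  proof -
    have "row i = (\<Sum>k<q. (\<lambda>j. a i k * (if j = k then 1 else 0)))"
      by (rule ext) (simp add: sum_apply row_def if_distrib[of "(*) _"] cong: if_cong)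
    also have "\<dots> \<in> V.span T"
      by (intro V.span_sum V.span_scale V.span_base) (auto simp: T_def)
    finally show ?thesis .
  qed
  ultimately have "card (row ` {..<p}) \<le> card T"
    using V.independent_span_bound[of T] by (auto simp: T_def)
  also have "\<dots> \<le> q" unfolding T_def using card_image_le[of "{..<q}"] by fastforce
  finally show "p \<le> q" by (simp add: card_image[OF inj])
qed

text \<open>
  Membership in \<open>(e\<^sub>1,\<dots>,e\<^sub>n)\<^sup>k E\<^sup>r\<close>.
\<close>

definition order_ge :: "nat \<Rightarrow> 'k::field vec \<Rightarrow> bool" where
  "order_ge k x \<longleftrightarrow> (\<forall>j S. x j S \<noteq> 0 \<longrightarrow> k \<le> card S)"

lemma order_ge_0 [simp]: "order_ge 0 x"
  by (simp add: order_ge_def)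

lemma order_ge_uminus: "order_ge k x \<Longrightarrow> order_ge k (- x)"
  by (simp add: order_ge_def)

lemma order_ge_1_iff: "x \<in> free_mod n r \<Longrightarrow> order_ge 1 x \<longleftrightarrow> (\<forall>j. x j {} = 0)"
  unfolding order_ge_def free_mod_iff
  by (metis One_nat_def Suc_leI card.empty card_gt_0_iff ext_support_finite not_one_le_zero)

lemma order_ge_smul_sum:
  assumes "\<forall>j<r. \<forall>S. c j S \<noteq> 0 \<longrightarrow> k \<le> card S" "\<forall>j<r. order_ge 1 (A j)"
  shows "order_ge (Suc k) (comb r A c)"
  unfolding order_ge_def
proof (intro allI impI)
  fix i S assume "comb r A c i S \<noteq> 0"
  then have "(\<Sum>j<r. (c j \<diamond> A j i) S) \<noteq> 0" by (simp add: comb_def sum_apply)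
  then obtain j where j: "j < r" "(c j \<diamond> A j i) S \<noteq> 0"
    by (meson lessThan_iff sum.not_neutral_contains_not_neutral)
  obtain B where B: "B \<subseteq> S" "c j B \<noteq> 0" "A j i (S - B) \<noteq> 0" using j(2) by (rule wedge_nonzeroE)
  have "finite S" using j(2) unfolding wedge_def by (meson finite_Pow_iff sum.infinite)
  then have "card S = card B + card (S - B)"
    using card_Un_disjoint[of B "S - B"] B(1) by (auto simp: Un_absorb1 dest: finite_subset)
  moreover have "k \<le> card B" "1 \<le> card (S - B)"
    using assms j(1) B by (auto simp: order_ge_def)
  ultimately show "Suc k \<le> card S" by simp
qed

lemma order_ge_eq_zero:
  assumes "x \<in> free_mod n r" "order_ge (Suc n) x"
  shows "x = 0"
proof (intro ext)
  fix j S
  show "x j S = 0 j S"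
  proof (rule ccontr)
    assume "x j S \<noteq> 0 j S"
    then have "x j S \<noteq> 0" by simp
    moreover have "x j \<in> ext n" using assms(1) by (simp add: free_mod_iff)
    ultimately have "S \<subseteq> {1..n}" "Suc n \<le> card S"
      using assms(2) unfolding ext_iff order_ge_def by blast+
    moreover from this(1) have "card S \<le> n" using card_mono[of "{1..n}" S] by simp
    ultimately show False by linarith
  qed
qed

text \<open>
  If \<open>\<gamma> - id\<close> maps into \<open>(e\<^sub>1,\<dots>,e\<^sub>n) E\<^sup>r\<close>, then by linearity it raises the order of every vector.  So
  a vector killed by \<open>\<gamma>\<close> has arbitrarily large order, hence is \<open>0\<close>, and \<open>x = \<gamma> x - (\<gamma> x - x)\<close> gives
  surjectivity by descending induction on the order.
\<close>

lemma bij_of_identity_mod_irrelevant: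
  assumes hom: "ext_linear n (free_mod n r) \<gamma>"
    and into: "\<gamma> ` free_mod n r \<subseteq> free_mod n r"
    and minimal: "\<forall>x\<in>free_mod n r. order_ge 1 (\<gamma> x - x)"
  shows "bij_betw \<gamma> (free_mod n r) (free_mod n r)"
proof -
  let ?F = "free_mod n r"
  have raise: "order_ge (Suc k) (\<gamma> x - x)" if "x \<in> ?F" "order_ge k x" for x k
  proof -
    have "\<gamma> x = comb r (\<lambda>j. \<gamma> (basis_vec j)) x"
      using ext_linear_comb[OF hom submodule_free_mod that(1), of basis_vec] that(1)
      by (simp add: basis_vec_closed comb_of_basis)
    then have "\<gamma> x - x = comb r (\<lambda>j. \<gamma> (basis_vec j)) x - comb r basis_vec x"
      using that(1) by (simp add: comb_of_basis)
    also have "\<dots> = comb r (\<lambda>j. \<gamma> (basis_vec j) - basis_vec j) x"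
      by (simp add: comb_def smul_simps sum_subtractf)
    finally have eq: "\<gamma> x - x = comb r (\<lambda>j. \<gamma> (basis_vec j) - basis_vec j) x" .
    show ?thesis
      unfolding eq
    proof (rule order_ge_smul_sum)
      show "\<forall>j<r. \<forall>S. x j S \<noteq> 0 \<longrightarrow> k \<le> card S" using that(2) by (simp add: order_ge_def)
      show "\<forall>j<r. order_ge 1 (\<gamma> (basis_vec j) - basis_vec j)"
        using minimal basis_vec_closed by blast
    qed
  qed
  have inj: "x = 0" if "x \<in> ?F" "\<gamma> x = 0" for x
  proof -
    have "order_ge k x" for k
    proof (induction k)
      case (Suc k)
      then show ?case using order_ge_uminus[OF raise[OF that(1)]] that(2) by simp
    qed simp
    then show ?thesis using order_ge_eq_zero that(1) by blast
  qed
  have sub: "\<gamma> (x - y) = \<gamma> x - \<gamma> y" if "x \<in> ?F" "y \<in> ?F" for x y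
  proof -
    have "\<gamma> x = \<gamma> (x - y) + \<gamma> y" using hom free_mod_diff[OF that] that(2)
      unfolding ext_linear_def by (metis diff_add_cancel)
    then show ?thesis by simp
  qed
  have surj: "x \<in> \<gamma> ` ?F" if "x \<in> ?F" "order_ge (Suc n - k) x" "k \<le> Suc n" for x k
    using that
  proof (induction k arbitrary: x)
    case 0
    then have "x = 0" using order_ge_eq_zero by auto
    then show ?case using ext_linear_zero[OF hom] by (metis free_mod_zero image_eqI)
  next
    case (Suc k)
    have "\<gamma> x - x \<in> ?F" using Suc.prems(1) into by (auto intro: free_mod_diff)
    moreover have "order_ge (Suc n - k) (\<gamma> x - x)"
      using raise[OF Suc.prems(1,2)] Suc.prems(3) by (simp add: Suc_diff_le)
    ultimately obtain y where "y \<in> ?F" "\<gamma> x - x = \<gamma> y" using Suc by auto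
    then have "\<gamma> (x - y) = \<gamma> x - (\<gamma> x - x)" using sub[OF Suc.prems(1)] by simp
    then have "x = \<gamma> (x - y)" by (simp only: diff_diff_eq2 add_diff_cancel_left')
    then show ?case using \<open>y \<in> ?F\<close> Suc.prems(1) free_mod_diff by blast
  qed
  have "inj_on \<gamma> ?F"
  proof (rule inj_onI)
    fix x y assume xy: "x \<in> ?F" "y \<in> ?F" "\<gamma> x = \<gamma> y"
    have "\<gamma> (x - y) = 0" unfolding sub[OF xy(1,2)] xy(3) by (rule diff_self)
    then have "x - y = 0" using inj free_mod_diff[OF xy(1,2)] by blast
    then show "x = y" by (rule eq_iff_diff_eq_0[THEN iffD2])
  qed
  moreover have "?F \<subseteq> \<gamma> ` ?F" using surj[of _ "Suc n"] by auto
  then have "\<gamma> ` ?F = ?F" using into by (rule subset_antisym[rotated])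
  ultimately show ?thesis by (simp add: bij_betw_def)
qed

text \<open>
  A free cover whose kernel lies in \<open>(e\<^sub>1,\<dots>,e\<^sub>n) E\<^sup>b\<close>.  The ambient free module of the \<open>A j\<close> is left open,
  because it changes along a resolution.
\<close>

definition minimal_cover :: "nat \<Rightarrow> nat \<Rightarrow> (nat \<Rightarrow> 'k::field vec) \<Rightarrow> 'k vec set \<Rightarrow> bool" where
  "minimal_cover n b A M \<longleftrightarrow> comb b A ` free_mod n b = M \<and>
     (\<forall>j<b. \<exists>s. A j \<in> free_mod n s) \<and>
     (\<forall>x\<in>free_mod n b. comb b A x = 0 \<longrightarrow> order_ge 1 x)"

lemma minimal_cover_submodule: "minimal_cover n b A M \<Longrightarrow> submodule n M"
  unfolding minimal_cover_def using submodule_image_comb by blast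

text \<open>
  Free modules are projective: choose preimages of the images of the basis vectors.
\<close>

lemma minimal_cover_lift:
  assumes A: "minimal_cover n b A M" and A': "minimal_cover n b' A' M'"
    and \<phi>: "ext_linear n M \<phi>" "\<phi> ` M \<subseteq> M'"
  obtains Y where "\<forall>j<b. Y j \<in> free_mod n b'"
    "\<And>x. x \<in> free_mod n b \<Longrightarrow> comb b' A' (comb b Y x) = \<phi> (comb b A x)"
proof -
  have A_in: "A j \<in> M" if j: "j < b" for j
  proof -
    obtain s where "A j \<in> free_mod n s" using A j by (auto simp: minimal_cover_def)
    then have "comb b A (basis_vec j) = A j" using j by (rule comb_basis_vec[rotated])
    then show ?thesis
      using A basis_vec_closed[OF j] unfolding minimal_cover_def by (metis image_eqI)
  qed
  then have "\<exists>y\<in>free_mod n b'. comb b' A' y = \<phi> (A j)" if "j < b" for j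
    using A' \<phi>(2) that unfolding minimal_cover_def by (metis image_iff image_subset_iff)
  then obtain Y where Y: "Y j \<in> free_mod n b'" "comb b' A' (Y j) = \<phi> (A j)" if "j < b" for j
    by metis
  have lift: "comb b' A' (comb b Y x) = \<phi> (comb b A x)" if x: "x \<in> free_mod n b" for x
  proof -
    have "comb b' A' (comb b Y x) = comb b (\<lambda>j. comb b' A' (Y j)) x"
      using ext_linear_comb[OF ext_linear_combI submodule_free_mod x] Y(1) by blast
    also have "\<dots> = comb b (\<lambda>j. \<phi> (A j)) x" using Y(2) by (intro comb_cong_upto) auto
    also have "\<dots> = \<phi> (comb b A x)"
      using ext_linear_comb[OF \<phi>(1) minimal_cover_submodule[OF A] x] A_in by simp
    finally show ?thesis .
  qed
  have "\<forall>j<b. Y j \<in> free_mod n b'" using Y(1) by blast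
  from this lift show thesis by (rule that)
qed

text \<open>
  A lift back and forth over the identity differs from the identity by elements of the kernel, which
  lies in \<open>(e\<^sub>1,\<dots>,e\<^sub>n) E\<^sup>b\<close>.  Reducing modulo \<open>(e\<^sub>1,\<dots>,e\<^sub>n)\<close> turns this into a right inverse of the matrix of
  constant terms, which bounds the rank.
\<close>

lemma round_trip:
  assumes "minimal_cover n b A M"
    and "\<forall>j<b. Y j \<in> free_mod n b'" "\<forall>j<b'. Z j \<in> free_mod n b"
    and "\<And>x. x \<in> free_mod n b \<Longrightarrow> comb b A (comb b' Z (comb b Y x)) = comb b A x"
  shows "bij_betw (\<lambda>x. comb b' Z (comb b Y x)) (free_mod n b) (free_mod n b)" and "b \<le> b'"
proof -
  let ?\<gamma> = "\<lambda>x. comb b' Z (comb b Y x)"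
  have into: "?\<gamma> x \<in> free_mod n b" if "x \<in> free_mod n b" for x
    using that assms(2,3) by (intro comb_closed) auto
  have min: "order_ge 1 (?\<gamma> x - x)" if "x \<in> free_mod n b" for x
  proof -
    have "comb b A (?\<gamma> x - x) = 0" using assms(4)[OF that] by (simp add: comb_linear)
    then show ?thesis
      using assms(1) into[OF that] that unfolding minimal_cover_def by (metis free_mod_diff)
  qed
  show "bij_betw ?\<gamma> (free_mod n b) (free_mod n b)"
    using into min by (intro bij_of_identity_mod_irrelevant) (auto simp: ext_linear_def comb_linear)
  have "(\<Sum>k<b'. Y i k {} * Z k j {}) = (if i = j then 1 else 0)" if ij: "i < b" "j < b" for i j
  proof -
    have "comb b Y (basis_vec i) = Y i" using ij(1) assms(2) comb_basis_vec by blast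
    then have "?\<gamma> (basis_vec i) j {} = (\<Sum>k<b'. Y i k {} * Z k j {})"
      by (simp add: comb_def[of b'] sum_apply)
    moreover have "(?\<gamma> (basis_vec i) - basis_vec i) j {} = 0"
      using min[OF basis_vec_closed[OF ij(1)]] into[OF basis_vec_closed[OF ij(1)]]
      by (subst (asm) order_ge_1_iff) (auto intro!: free_mod_diff basis_vec_closed ij)
    ultimately show ?thesis by (auto simp: basis_vec_def emon_def)
  qed
  then show "b \<le> b'" by (rule scalar_matrix_inverse_le)
qed

theorem minimal_cover_unique:
  fixes A A' :: "nat \<Rightarrow> 'k::field vec"
  assumes A: "minimal_cover n b A M" and A': "minimal_cover n b' A' M'"
    and \<phi>: "ext_linear n M \<phi>" "bij_betw \<phi> M M'"
  defines "K \<equiv> {x \<in> free_mod n b. comb b A x = 0}"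
    and "K' \<equiv> {x \<in> free_mod n b'. comb b' A' x = 0}"
  shows "b = b'" and "\<exists>\<alpha>. ext_linear n K \<alpha> \<and> bij_betw \<alpha> K K'"
proof -
  let ?\<psi> = "inv_into M \<phi>"
  have \<psi>: "ext_linear n M' ?\<psi>" "bij_betw ?\<psi> M' M"
    using ext_linear_inverse[OF \<phi>(1) minimal_cover_submodule[OF A] \<phi>(2)] bij_betw_inv_into[OF \<phi>(2)]
    by auto
  obtain Y where Y: "\<forall>j<b. Y j \<in> free_mod n b'"
    "\<And>x. x \<in> free_mod n b \<Longrightarrow> comb b' A' (comb b Y x) = \<phi> (comb b A x)"
    using minimal_cover_lift[OF A A' \<phi>(1)] \<phi>(2) by (auto simp: bij_betw_def)
  obtain Z where Z: "\<forall>j<b'. Z j \<in> free_mod n b"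
    "\<And>x. x \<in> free_mod n b' \<Longrightarrow> comb b A (comb b' Z x) = ?\<psi> (comb b' A' x)"
    using minimal_cover_lift[OF A' A \<psi>(1)] \<psi>(2) by (auto simp: bij_betw_def)
  have M: "comb b A x \<in> M" if "x \<in> free_mod n b" for x using A that by (auto simp: minimal_cover_def)
  have M': "comb b' A' x \<in> M'" if "x \<in> free_mod n b'" for x using A' that by (auto simp: minimal_cover_def)
  have Yc: "comb b Y x \<in> free_mod n b'" if "x \<in> free_mod n b" for x using comb_closed[OF that Y(1)] .
  have Zc: "comb b' Z x \<in> free_mod n b" if "x \<in> free_mod n b'" for x using comb_closed[OF that Z(1)] .
  have ZY: "comb b A (comb b' Z (comb b Y x)) = comb b A x" if "x \<in> free_mod n b" for x
    using Z(2)[OF Yc[OF that]] Y(2)[OF that] M[OF that] \<phi>(2) by (simp add: bij_betw_inv_into_left)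
  have YZ: "comb b' A' (comb b Y (comb b' Z x)) = comb b' A' x" if "x \<in> free_mod n b'" for x
    using Y(2)[OF Zc[OF that]] Z(2)[OF that] M'[OF that] \<phi>(2) by (simp add: bij_betw_inv_into_right)
  note r = round_trip[OF A Y(1) Z(1) ZY] and r' = round_trip[OF A' Z(1) Y(1) YZ]
  show "b = b'" using r(2) r'(2) by simp
  let ?\<alpha> = "comb b Y"
  have "inj_on ?\<alpha> (free_mod n b)"
    using r(1) by (auto simp: bij_betw_def inj_on_def)
  moreover have "?\<alpha> ` free_mod n b = free_mod n b'"
  proof
    show "?\<alpha> ` free_mod n b \<subseteq> free_mod n b'" using Yc by auto
    show "free_mod n b' \<subseteq> ?\<alpha> ` free_mod n b"
    proof
      fix y :: "'k vec" assume "y \<in> free_mod n b'"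
      then obtain x where "x \<in> free_mod n b'" "y = ?\<alpha> (comb b' Z x)"
        using r'(1) by (auto simp: bij_betw_def)
      then show "y \<in> ?\<alpha> ` free_mod n b" using Zc by auto
    qed
  qed
  ultimately have inj: "inj_on ?\<alpha> (free_mod n b)" and im: "?\<alpha> ` free_mod n b = free_mod n b'" .
  have "0 \<in> M" using minimal_cover_submodule[OF A] by (simp add: submodule_def)
  then have ker: "x \<in> K \<longleftrightarrow> ?\<alpha> x \<in> K'" if "x \<in> free_mod n b" for x
    using Y(2)[OF that] M[OF that] \<phi>(2) that Yc[OF that] ext_linear_zero[OF \<phi>(1)]
    unfolding K_def K'_def by (auto simp: bij_betw_def inj_on_def)
  have "?\<alpha> ` K = K'"
  proof
    show "?\<alpha> ` K \<subseteq> K'" using ker by (auto simp: K_def)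
    show "K' \<subseteq> ?\<alpha> ` K"
    proof
      fix y assume y: "y \<in> K'"
      then obtain x where "x \<in> free_mod n b" "y = ?\<alpha> x" using im by (auto simp: K'_def)
      then show "y \<in> ?\<alpha> ` K" using ker y by auto
    qed
  qed
  moreover have "inj_on ?\<alpha> K" using inj by (rule inj_on_subset) (auto simp: K_def)
  ultimately show "\<exists>\<alpha>. ext_linear n K \<alpha> \<and> bij_betw \<alpha> K K'"
    by (intro exI[of _ ?\<alpha>]) (auto simp: bij_betw_def ext_linear_def comb_linear)
qed

section \<open>Monomial ideals\<close>

text \<open>
  The ideal generated by the monomials \<open>e\<^sub>\<tau>\<close>, \<open>\<tau> \<in> G\<close>, described by the supports of its elements.
\<close>

definition monomial_span :: "nat \<Rightarrow> nat set set \<Rightarrow> (nat set \<Rightarrow> 'k::field) set" where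
  "monomial_span n G = {f \<in> ext n. \<forall>S. f S \<noteq> 0 \<longrightarrow> (\<exists>\<tau>\<in>G. \<tau> \<subseteq> S)}"

lemma monomial_span_empty [simp]: "monomial_span n {} = {0}"
  by (auto simp: monomial_span_def fun_eq_iff)

lemma wedge_emon_support: "(f \<diamond> emon \<tau>) S \<noteq> 0 \<Longrightarrow> \<tau> \<subseteq> S"
  by (erule wedge_nonzeroE) (auto simp: emon_def split: if_splits)

text \<open>
  Split off the part of \<open>f\<close> whose monomials are divisible by \<open>e\<^sub>u\<close>.  This is the form in which membership in
  the span of a list unfolds (\<open>gen_snoc_iff\<close>).
\<close>

lemma monomial_span_insert:
  assumes "u \<subseteq> {1..n}" "f \<in> ext n"
  shows "f \<in> monomial_span n (insert u G) \<longleftrightarrow> (\<exists>h\<in>ext n. f - h \<diamond> emon u \<in> monomial_span n G)"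
proof
  assume f: "f \<in> monomial_span n (insert u G)"
  define g where "g = (\<lambda>S. if u \<subseteq> S then f S else 0)"
  have g: "g \<in> ext n" using assms(2) by (simp add: ext_iff g_def)
  obtain h where h: "h \<in> ext n" "g = h \<diamond> emon u"
    by (rule multiple_of_emon[OF g assms(1)]) (auto simp: g_def split: if_splits)
  have "f - g \<in> monomial_span n G"
    using f ext_diff[OF assms(2) g] by (auto simp: monomial_span_def g_def)
  then show "\<exists>h\<in>ext n. f - h \<diamond> emon u \<in> monomial_span n G" using h by auto
next
  assume "\<exists>h\<in>ext n. f - h \<diamond> emon u \<in> monomial_span n G"
  then obtain h where h: "h \<in> ext n" "f - h \<diamond> emon u \<in> monomial_span n G" by blast
  have "\<exists>\<tau>\<in>insert u G. \<tau> \<subseteq> S" if "f S \<noteq> 0" for S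
  proof (cases "(h \<diamond> emon u) S = 0")
    case True
    then have "(f - h \<diamond> emon u) S \<noteq> 0" using that by simp
    then show ?thesis using h(2) by (auto simp: monomial_span_def)
  qed (use wedge_emon_support in blast)
  then show "f \<in> monomial_span n (insert u G)" using assms(2) by (simp add: monomial_span_def)
qed

lemma Idl_emon_eq:
  assumes "G \<subseteq> Pow {1..n}"
  shows "Idl\<^bsub>exterior n\<^esub> (emon ` G) = (monomial_span n G :: (nat set \<Rightarrow> 'k::field) set)"
proof
  interpret ring "exterior n :: (nat set \<Rightarrow> 'k) ring" by (rule ring_exterior)
  let ?L = "Idl\<^bsub>exterior n\<^esub> (emon ` G) :: (nat set \<Rightarrow> 'k) set"
  have sub: "emon ` G \<subseteq> (ext n :: (nat set \<Rightarrow> 'k) set)" using assms emon_ext by blast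
  have "emon ` G \<subseteq> (monomial_span n G :: (nat set \<Rightarrow> 'k) set)"
    using sub by (auto simp: monomial_span_def) (auto simp: emon_def split: if_splits)
  then show "?L \<subseteq> monomial_span n G"
    unfolding monomial_span_def by (rule genideal_minimal[OF ideal_multiples])
  interpret L: ideal ?L "exterior n" by (rule genideal_ideal[OF sub])
  have "monomial_span n H \<subseteq> ?L" if "finite H" "H \<subseteq> G" for H
    using that
  proof (induction H rule: finite_induct)
    case empty
    show ?case using L.zero_closed by (simp add: exterior_ops)
  next
    case (insert u H)
    show ?case
    proof
      fix f :: "nat set \<Rightarrow> 'k" assume f: "f \<in> monomial_span n (insert u H)"
      then have "f \<in> ext n" by (simp add: monomial_span_def)
      moreover have "u \<subseteq> {1..n}" using insert.prems assms by blast
      ultimately obtain h where h: "h \<in> ext n" "f - h \<diamond> emon u \<in> monomial_span n H"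
        using f monomial_span_insert[of u n f H] by blast
      have "emon u \<in> ?L" using genideal_self[OF sub] insert.prems by blast
      then have "h \<diamond> emon u \<in> ?L" using L.I_l_closed[OF _ h(1)] by (simp add: exterior_ops)
      moreover have "f - h \<diamond> emon u \<in> ?L" using h(2) insert.IH insert.prems by blast
      ultimately have "(f - h \<diamond> emon u) + h \<diamond> emon u \<in> ?L"
        using L.a_closed[unfolded exterior_ops(2)] by blast
      then show "f \<in> ?L" by (simp only: diff_add_cancel)
    qed
  qed
  moreover have "finite G" using assms finite_subset by blast
  ultimately show "monomial_span n G \<subseteq> ?L" by blast
qed

lemma irrelevant_ideal_eq: "irrelevant_ideal n = (var_ideal n n :: (nat set \<Rightarrow> 'k::field) set)"
proof -
  have "(\<lambda>i. emon {i} :: nat set \<Rightarrow> 'k) ` {1..n} = emon ` ((\<lambda>i. {i}) ` {1..n})"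
    by (simp add: image_image)
  moreover have "(\<lambda>i. {i}) ` {1..n} \<subseteq> Pow {1..n}" by auto
  ultimately have "irrelevant_ideal n = (monomial_span n ((\<lambda>i. {i}) ` {1..n}) :: (nat set \<Rightarrow> 'k) set)"
    unfolding irrelevant_ideal_def by (simp only: Idl_emon_eq)
  also have "\<dots> = var_ideal n n"
    unfolding monomial_span_def var_ideal_def by auto
  finally show ?thesis .
qed

lemma gen_monomials:
  fixes us :: "nat set list"
  assumes "set us \<subseteq> Pow {1..n}"
  shows "gen n (map (\<lambda>u. embed_vec (emon u)) us) = (embed_vec ` monomial_span n (set us) :: 'k::field vec set)"
  using assms
proof (induction us rule: rev_induct)
  case Nil
  show ?case
    by (simp only: list.map list.set gen_Nil monomial_span_empty image_insert image_empty embed_vec_0)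
next
  case (snoc u us)
  have u: "u \<subseteq> {1..n}" and IH: "gen n (map (\<lambda>u. embed_vec (emon u)) us) = (embed_vec ` monomial_span n (set us) :: 'k vec set)"
    using snoc by auto
  have "(y :: 'k vec) \<in> gen n (map (\<lambda>u. embed_vec (emon u)) (us @ [u])) \<longleftrightarrow>
      y \<in> embed_vec ` monomial_span n (set (us @ [u]))" for y
  proof -
    have "y \<in> gen n (map (\<lambda>u. embed_vec (emon u)) (us @ [u])) \<longleftrightarrow>
        (\<exists>h\<in>ext n. y - embed_vec (h \<diamond> emon u) \<in> embed_vec ` monomial_span n (set us))"
      by (simp add: gen_snoc_iff IH embed_vec_simps)
    also have "\<dots> \<longleftrightarrow> (\<exists>f\<in>ext n. y = embed_vec f \<and> (\<exists>h\<in>ext n. f - h \<diamond> emon u \<in> monomial_span n (set us)))"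
      (is "?l \<longleftrightarrow> ?r")
    proof
      assume ?l
      then obtain h g where h: "h \<in> ext n" "g \<in> monomial_span n (set us)" "y - embed_vec (h \<diamond> emon u) = embed_vec g"
        by blast
      have "y = embed_vec (g + h \<diamond> emon u)" using h(3) by (simp only: embed_vec_simps) (simp add: algebra_simps)
      moreover have "g + h \<diamond> emon u \<in> ext n"
        using h u by (intro ext_add ext_wedge emon_ext) (auto simp: monomial_span_def)
      moreover have "g + h \<diamond> emon u - h \<diamond> emon u \<in> monomial_span n (set us)" using h(2) by simp
      ultimately show ?r using h(1) by blast
    next
      assume ?r
      then obtain f h where "f \<in> ext n" "y = embed_vec f" "h \<in> ext n" "f - h \<diamond> emon u \<in> monomial_span n (set us)"
        by blast
      then show ?l by (intro bexI[of _ h]) (auto simp flip: embed_vec_simps(3))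
    qed
    also have "\<dots> \<longleftrightarrow> y \<in> embed_vec ` monomial_span n (set (us @ [u]))"
    proof -
      have "f \<in> monomial_span n (set (us @ [u])) \<longleftrightarrow>
          f \<in> ext n \<and> (\<exists>h\<in>ext n. f - h \<diamond> emon u \<in> monomial_span n (set us))" for f :: "nat set \<Rightarrow> 'k"
        using monomial_span_insert[OF u, of f "set us"] by (auto simp: monomial_span_def)
      then show ?thesis by blast
    qed
    finally show ?thesis .
  qed
  then show ?case by (rule Set.set_eqI)
qed

text \<open>
  The exchange property of stable ideals, on the generators of an ideal generated in one degree: only
  the largest index gets replaced.
\<close>

definition stable_set :: "nat set set \<Rightarrow> bool" where
  "stable_set G \<longleftrightarrow> (\<forall>u\<in>G. \<forall>i\<in>{1..<Max u}. i \<notin> u \<longrightarrow> insert i (u - {Max u}) \<in> G)"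

text \<open>
  If \<open>i < max u\<close> is not in \<open>u\<close>, exchanging \<open>max u\<close> for \<open>i\<close> yields an earlier generator that divides
  \<open>e\<^sub>i \<and> e\<^sub>u\<close>; if \<open>i \<in> u\<close>, the product is \<open>0\<close>.  Conversely, a product \<open>e\<^sub>S \<and> e\<^sub>u\<close> in which
  \<open>S\<close> lies beyond \<open>max u\<close> has only one divisor of degree \<open>d\<close> inside \<open>{1..max u}\<close>, namely \<open>u\<close>.
\<close>

lemma colon_of_monomial:
  fixes f :: "nat set \<Rightarrow> 'k::field"
  assumes u: "u \<subseteq> {1..n}" "card u = d" "u \<noteq> {}"
    and G: "\<forall>v\<in>G. v \<subseteq> {1..n} \<and> card v = d \<and> Max v \<le> Max u" "u \<notin> G"
    and swap: "\<forall>i\<in>{1..<Max u}. i \<notin> u \<longrightarrow> insert i (u - {Max u}) \<in> G"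
    and f: "f \<in> ext n"
  shows "f \<diamond> emon u \<in> monomial_span n G \<longleftrightarrow> f \<in> var_ideal n (Max u)"
proof
  have fin_u: "finite u" using u(1) finite_subset by blast
  assume span: "f \<diamond> emon u \<in> monomial_span n G"
  have "S \<inter> {1..Max u} \<noteq> {}" if S: "f S \<noteq> 0" for S
  proof
    assume disj: "S \<inter> {1..Max u} = {}"
    have "u \<subseteq> {1..Max u}" using u(1) fin_u by auto
    then have "u \<inter> S = {}" using disj by blast
    then have "S \<union> u - u = S" by blast
    moreover have fin_S: "finite S" using ext_support_finite[OF f S] .
    ultimately have "(f \<diamond> emon u) (S \<union> u) = wedge_sign S u * f S"
      using fin_u by (simp add: wedge_emon)
    moreover have "wedge_sign S u \<noteq> (0::'k)"
      using wedge_sign_square[of S u, where 'k = 'k] by auto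
    ultimately have "(f \<diamond> emon u) (S \<union> u) \<noteq> 0" using S by simp
    then obtain v where v: "v \<in> G" "v \<subseteq> S \<union> u"
      using span unfolding monomial_span_def by blast
    have "v \<subseteq> u"
    proof
      fix x assume x: "x \<in> v"
      have "finite v" using v(2) fin_u fin_S finite_subset by blast
      then have "x \<le> Max u" using x G(1) v(1) Max_ge[of v x] by (meson le_trans)
      moreover have "x \<in> {1..n}" using G(1) v(1) x by blast
      ultimately show "x \<in> u" using v(2) x disj by auto
    qed
    then have "v = u" using G(1) v(1) u(2) card_subset_eq[OF fin_u] by simp
    then show False using v(1) G(2) by simp
  qed
  then show "f \<in> var_ideal n (Max u)" using f by (simp add: var_ideal_def)
next
  assume var: "f \<in> var_ideal n (Max u)"
  have fin_u: "finite u" using u(1) finite_subset by blast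
  have "\<exists>v\<in>G. v \<subseteq> S" if S: "(f \<diamond> emon u) S \<noteq> 0" for S
  proof -
    obtain A where A: "A \<subseteq> S" "f A \<noteq> 0" "emon u (S - A) \<noteq> (0::'k)"
      using S by (rule wedge_nonzeroE)
    then have SA: "S - A = u" by (auto simp: emon_def split: if_splits)
    obtain i where i: "i \<in> A" "i \<in> {1..Max u}" using var A(2) unfolding var_ideal_def by blast
    have "i \<notin> u" using SA i(1) by auto
    moreover have "Max u \<in> u" using fin_u u(3) by simp
    ultimately have "i \<in> {1..<Max u}" using i(2) by (metis atLeastAtMost_iff atLeastLessThan_iff le_neq_implies_less)
    then have "insert i (u - {Max u}) \<in> G" using swap \<open>i \<notin> u\<close> by blast
    moreover have "insert i (u - {Max u}) \<subseteq> S" using SA A(1) i(1) by auto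
    ultimately show ?thesis by blast
  qed
  moreover have "f \<diamond> emon u \<in> ext n" using f emon_ext[OF u(1)] by (rule ext_wedge)
  ultimately show "f \<diamond> emon u \<in> monomial_span n G" by (simp add: monomial_span_def)
qed

lemma swap_Mon:
  assumes "u \<in> Mon n d" "1 \<le> d" "i \<in> {1..<Max u}" "i \<notin> u"
  shows "insert i (u - {Max u}) \<in> Mon n d" "Max (insert i (u - {Max u})) < Max u"
proof -
  have u: "u \<subseteq> {1..n}" "card u = d" "finite u" "u \<noteq> {}"
    using assms(1,2) finite_subset[of u "{1..n}"] by (auto simp: Mon_def)
  have Max_u: "Max u \<in> u" using u by simp
  then have "i \<in> {1..n}" using assms(3) u(1) by fastforce
  moreover have "card (insert i (u - {Max u})) = d"
    using u Max_u assms(2,4) by (simp add: card_Diff_singleton)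
  ultimately show "insert i (u - {Max u}) \<in> Mon n d" using u(1) by (auto simp: Mon_def)
  have "x < Max u" if "x \<in> insert i (u - {Max u})" for x
    using that assms(3) u(3) Max_ge[of u x] by (auto simp: order_less_le)
  then show "Max (insert i (u - {Max u})) < Max u" using u(3) by (subst Max_less_iff) auto
qed

text \<open>
  The exchange strictly lowers the largest index, so an initial part of the list is again stable, and ties
  between equal largest indices may be broken arbitrarily.
\<close>

lemma linear_quotients_monomials:
  assumes "sorted (map Max us)" "distinct us" "\<forall>u\<in>set us. u \<subseteq> {1..n} \<and> card u = d" "1 \<le> d"
    "stable_set (set us)"
  shows "linear_quotients n 1 d (map (\<lambda>u. embed_vec (emon u) :: 'k::field vec) us) (map Max us)"
  using assms
proof (induction us rule: rev_induct)
  case Nil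
  show ?case by (simp add: linear_quotients.Nil)
next
  case (snoc u us)
  have u: "u \<subseteq> {1..n}" "card u = d" "u \<noteq> {}" "finite u"
    using snoc.prems(3,4) finite_subset[of u "{1..n}"] by auto
  have ord: "Max v \<le> Max u" if "v \<in> set us" for v
    using snoc.prems(1) that by (auto simp: sorted_append)
  have swap: "insert i (v - {Max v}) \<in> set us"
    if "v \<in> set (us @ [u])" "i \<in> {1..<Max v}" "i \<notin> v" for v i
  proof -
    have "insert i (v - {Max v}) \<in> set (us @ [u])"
      using snoc.prems(5) that unfolding stable_set_def by blast
    moreover have "insert i (v - {Max v}) \<noteq> u"
    proof
      assume "insert i (v - {Max v}) = u"
      moreover have "v \<in> Mon n d" using snoc.prems(3) that(1) by (auto simp: Mon_def)
      ultimately have "Max u < Max v" using swap_Mon(2)[OF _ snoc.prems(4) that(2,3)] by metis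
      moreover have "Max v \<le> Max u" using ord that(1) by auto
      ultimately show False by simp
    qed
    ultimately show ?thesis by simp
  qed
  have IH: "linear_quotients n 1 d (map (\<lambda>u. embed_vec (emon u) :: 'k vec) us) (map Max us)"
  proof (rule snoc.IH)
    show "stable_set (set us)" unfolding stable_set_def using swap by auto
  qed (use snoc.prems in \<open>auto simp: sorted_append\<close>)
  have colon: "f \<triangleright> embed_vec (emon u) \<in> gen n (map (\<lambda>u. embed_vec (emon u)) us) \<longleftrightarrow> f \<in> var_ideal n (Max u)"
    if f: "f \<in> ext n" for f :: "nat set \<Rightarrow> 'k"
  proof -
    have "set us \<subseteq> Pow {1..n}" using snoc.prems(3) by auto
    then have "f \<triangleright> embed_vec (emon u) \<in> gen n (map (\<lambda>u. embed_vec (emon u)) us) \<longleftrightarrow>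
        f \<diamond> emon u \<in> monomial_span n (set us)"
      by (simp only: gen_monomials embed_vec_simps(2)) (auto simp: embed_vec_simps(4))
    also have "\<dots> \<longleftrightarrow> f \<in> var_ideal n (Max u)"
      using snoc.prems(2,3) ord swap[of u] f by (intro colon_of_monomial[OF u(1-3)]) auto
    finally show ?thesis .
  qed
  have "Max u \<le> n" using u Max_in[of u] by auto
  moreover have "\<forall>k. homog d ((embed_vec (emon u) :: 'k vec) k)"
    using u(2) homog_emon[of u] by (auto simp: embed_vec_def homog_def)
  moreover have "(embed_vec (emon u) :: 'k vec) \<in> free_mod n 1"
    using emon_ext[OF u(1)] by (simp only: embed_vec_closed)
  ultimately show ?case
    unfolding map_append list.map using IH colon by (intro linear_quotients.snoc) blast+
qed

section \<open>Betti numbers of stable ideals generated in one degree\<close>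

text \<open>
  All maps of a resolution in one sequence, with the augmentation in position \<open>0\<close>.
\<close>

definition aug_matrix :: "(nat \<Rightarrow> nat set \<Rightarrow> 'k::field) \<Rightarrow> (nat \<Rightarrow> nat \<Rightarrow> 'k vec) \<Rightarrow> nat \<Rightarrow> nat \<Rightarrow> 'k vec" where
  "aug_matrix g D i = (case i of 0 \<Rightarrow> (\<lambda>j. embed_vec (g j)) | Suc i \<Rightarrow> D i)"

definition syzygy_module :: "nat \<Rightarrow> (nat \<Rightarrow> nat) \<Rightarrow> (nat \<Rightarrow> nat \<Rightarrow> 'k::field vec) \<Rightarrow> nat \<Rightarrow> 'k vec set" where
  "syzygy_module n b A i = {x \<in> free_mod n (b i). comb (b i) (A i) x = 0}"

lemma resolution_covers:
  fixes I :: "(nat set \<Rightarrow> 'k::field) set"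
  assumes res: "min_graded_free_resolution n I b a g D"
  defines "A \<equiv> aug_matrix g D"
  shows "minimal_cover n (b 0) (A 0) (embed_vec ` I)"
    and "minimal_cover n (b (Suc i)) (A (Suc i)) (syzygy_module n b A i)"
proof -
  note R = res[unfolded min_graded_free_resolution_def]
  note gens = R[THEN conjunct1]
    and diffs = R[THEN conjunct2, THEN conjunct1]
    and onto = R[THEN conjunct2, THEN conjunct2, THEN conjunct1]
    and exact_0 = R[THEN conjunct2, THEN conjunct2, THEN conjunct2, THEN conjunct1]
    and exact_Suc = R[THEN conjunct2, THEN conjunct2, THEN conjunct2, THEN conjunct2, THEN conjunct1]
    and minimal = R[THEN conjunct2, THEN conjunct2, THEN conjunct2, THEN conjunct2, THEN conjunct2]
  have g: "\<forall>j<b 0. g j \<in> ext n"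
    using gens by simp
  have D: "\<forall>j<b (Suc i). D i j \<in> free_mod n (b i)" for i
    using diffs by simp
  have irr: "\<forall>j<b (Suc i). \<forall>k<b i. D i j k \<in> irrelevant_ideal n" for i
    using minimal by simp
  have ord: "\<forall>j<b (Suc i). order_ge 1 (D i j)" for i
  proof (intro allI impI)
    fix j assume j: "j < b (Suc i)"
    have "D i j k {} = 0" for k
      using irr[of i] D[of i] j by (cases "k < b i") (auto simp: irrelevant_ideal_eq var_ideal_def free_mod_iff)
    then show "order_ge 1 (D i j)" using D j by (subst order_ge_1_iff) auto
  qed
  have im0: "comb (b 0) (A 0) ` free_mod n (b 0) = embed_vec ` I"
  proof -
    have "embed_vec ` I = (\<lambda>c. embed_vec (free_aug n (b 0) g c)) ` free_mod n (b 0)"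
      unfolding onto[symmetric] by (rule image_image)
    also have "\<dots> = comb (b 0) (A 0) ` free_mod n (b 0)"
      using free_aug_eq_comb[OF g] by (intro image_cong) (auto simp: A_def aug_matrix_def)
    finally show ?thesis by simp
  qed
  have im: "comb (b (Suc i)) (A (Suc i)) ` free_mod n (b (Suc i)) = syzygy_module n b A i" for i
  proof -
    have "comb (b (Suc i)) (A (Suc i)) ` free_mod n (b (Suc i)) =
        free_map n (b (Suc i)) (D i) ` free_mod n (b (Suc i))"
      using free_map_eq_comb[OF D] by (intro image_cong) (auto simp: A_def aug_matrix_def)
    also have "\<dots> = syzygy_module n b A i"
    proof (cases i)
      case 0
      note exact_0
      moreover have "free_aug n (b 0) g x = 0 \<longleftrightarrow> comb (b 0) (A 0) x = 0" if "x \<in> free_mod n (b 0)" for x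
        using free_aug_eq_comb[OF g that] embed_vec_simps(4)[of "free_aug n (b 0) g x" 0]
        by (simp add: A_def aug_matrix_def)
      ultimately show ?thesis using 0 by (auto simp: syzygy_module_def exterior_ops)
    next
      case (Suc k)
      have "free_map n (b (k + 2)) (D (k + 1)) ` free_mod n (b (k + 2)) =
          {x \<in> free_mod n (b (k + 1)). free_map n (b (k + 1)) (D k) x = (\<lambda>j. \<zero>\<^bsub>exterior n\<^esub>)}"
        using exact_Suc by blast
      moreover have "(\<lambda>j::nat. \<zero>\<^bsub>exterior n\<^esub>) = (0 :: 'k vec)" by (auto simp: exterior_ops)
      moreover have "free_map n (b (k + 1)) (D k) x = comb (b i) (A i) x" if "x \<in> free_mod n (b (k + 1))" for x
        using free_map_eq_comb[OF D, of x] that Suc by (simp add: A_def aug_matrix_def)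
      ultimately show ?thesis using Suc by (auto simp: syzygy_module_def)
    qed
    finally show ?thesis .
  qed
  have min: "order_ge 1 x" if "x \<in> syzygy_module n b A i" for x i
  proof -
    have "x \<in> comb (b (Suc i)) (A (Suc i)) ` free_mod n (b (Suc i))" unfolding im by (rule that)
    then obtain c where "x = comb (b (Suc i)) (A (Suc i)) c" by blast
    then have "x = comb (b (Suc i)) (D i) c" by (simp add: A_def aug_matrix_def)
    then show ?thesis using order_ge_smul_sum[of "b (Suc i)" c 0 "D i"] ord by simp
  qed
  show "minimal_cover n (b 0) (A 0) (embed_vec ` I)"
    unfolding minimal_cover_def
  proof (intro conjI ballI impI)
    have "A 0 j \<in> free_mod n 1" if "j < b 0" for j
      using g that by (simp only: A_def aug_matrix_def nat.case embed_vec_closed)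
    then show "\<forall>j<b 0. \<exists>s. A 0 j \<in> free_mod n s" by blast
    show "order_ge 1 x" if "x \<in> free_mod n (b 0)" "comb (b 0) (A 0) x = 0" for x
      using min[of x 0] that by (simp add: syzygy_module_def)
  qed (fact im0)
  show "minimal_cover n (b (Suc i)) (A (Suc i)) (syzygy_module n b A i)"
    unfolding minimal_cover_def
  proof (intro conjI ballI impI)
    show "\<forall>j<b (Suc i). \<exists>s. A (Suc i) j \<in> free_mod n s"
      using D by (auto simp: A_def aug_matrix_def)
    show "order_ge 1 x" if "x \<in> free_mod n (b (Suc i))" "comb (b (Suc i)) (A (Suc i)) x = 0" for x
      using min[of x "Suc i"] that by (simp add: syzygy_module_def)
  qed (fact im)
qed

text \<open>
  The ranks agree and the syzygy modules are isomorphic, by simultaneous induction.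
\<close>

theorem min_graded_free_resolution_ranks_unique:
  fixes I :: "(nat set \<Rightarrow> 'k::field) set"
  assumes res: "min_graded_free_resolution n I b a g D"
    and res': "min_graded_free_resolution n I b' a' g' D'"
  shows "b i = b' i"
proof -
  let ?K = "syzygy_module n b (aug_matrix g D)" and ?K' = "syzygy_module n b' (aug_matrix g' D')"
  have "b i = b' i \<and> (\<exists>\<alpha>. ext_linear n (?K i) \<alpha> \<and> bij_betw \<alpha> (?K i) (?K' i))"
  proof (induction i)
    case 0
    have "ext_linear n (embed_vec ` I) id" by (simp add: ext_linear_def)
    then show ?case
      using minimal_cover_unique[OF resolution_covers(1)[OF res] resolution_covers(1)[OF res'], of id]
      by (simp add: syzygy_module_def)
  next
    case (Suc i)
    then obtain \<alpha> where \<alpha>: "ext_linear n (?K i) \<alpha>" "bij_betw \<alpha> (?K i) (?K' i)" by blast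
    show ?case
      using minimal_cover_unique[OF resolution_covers(2)[OF res, of i] resolution_covers(2)[OF res', of i] \<alpha>]
      by (simp only: syzygy_module_def)
  qed
  then show ?thesis ..
qed

lemma betti_eq:
  assumes "min_graded_free_resolution n I b a g D"
  shows "betti n I i = b i"
  unfolding betti_def
proof (rule the_equality)
  fix r assume "\<exists>b a g D. min_graded_free_resolution n I b a g D \<and> r = b i"
  then show "r = b i" using min_graded_free_resolution_ranks_unique[OF _ assms] by metis
qed (use assms in blast)

lemma iterated_syzygies:
  assumes "linear_quotients n r c xs ms"
  obtains X where "X 0 = xs" "\<And>i. length (X i) = length ((split_bounds ^^ i) ms)"
    "\<And>i. gen n (X (Suc i)) = syz n (X i)"
    "\<And>i x k. x \<in> set (X (Suc i)) \<Longrightarrow> x \<in> free_mod n (length (X i)) \<and> homog 1 (x k)"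
proof -
  define P where "P i zs \<longleftrightarrow> (i = 0 \<longrightarrow> zs = xs) \<and> (\<exists>r c. linear_quotients n r c zs ((split_bounds ^^ i) ms))" for i zs
  define Q where "Q i ys zs \<longleftrightarrow> linear_quotients n (length ys) 1 zs ((split_bounds ^^ Suc i) ms) \<and> gen n zs = syz n ys"
    for i :: nat and ys zs :: "'a vec list"
  have "\<exists>X. \<forall>i. P i (X i) \<and> Q i (X i) (X (Suc i))"
  proof (rule dependent_nat_choice)
    show "\<exists>zs. P 0 zs" using assms by (auto simp: P_def)
  next
    fix ys i assume "P i ys"
    then obtain r c where "linear_quotients n r c ys ((split_bounds ^^ i) ms)" by (auto simp: P_def)
    from linear_quotients_syzygies[OF this] obtain zs where
      "linear_quotients n (length ys) 1 zs (split_bounds ((split_bounds ^^ i) ms))" "gen n zs = syz n ys"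
      by blast
    then have "P (Suc i) zs \<and> Q i ys zs" by (auto simp: P_def Q_def)
    then show "\<exists>zs. P (Suc i) zs \<and> Q i ys zs" by blast
  qed
  then obtain X where X: "\<And>i. P i (X i)" "\<And>i. Q i (X i) (X (Suc i))" by blast
  show thesis
  proof (rule that[of X])
    show "X 0 = xs" using X(1)[of 0] by (simp add: P_def)
    show "length (X i) = length ((split_bounds ^^ i) ms)" for i
      using X(1)[of i] linear_quotients_length by (auto simp: P_def)
    show "gen n (X (Suc i)) = syz n (X i)" for i using X(2)[of i] by (simp add: Q_def)
    show "x \<in> free_mod n (length (X i)) \<and> homog 1 (x k)" if "x \<in> set (X (Suc i))" for i x k
      using X(2)[of i] linear_quotients_elem[OF _ that] by (auto simp: Q_def)
  qed
qed

text \<open>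
  All differentials have entries of degree \<open>1\<close>, so the resolution is graded and minimal.
\<close>

lemma linear_quotients_resolution:
  fixes us :: "(nat set \<Rightarrow> 'k::field) list"
  assumes lq: "linear_quotients n 1 d (map embed_vec us) ms" and I: "gen n (map embed_vec us) = embed_vec ` I"
  shows "\<exists>a g D. min_graded_free_resolution n I (\<lambda>i. length ((split_bounds ^^ i) ms)) a g D"
proof -
  obtain X where X0: "X 0 = map embed_vec us" and len: "\<And>i. length (X i) = length ((split_bounds ^^ i) ms)"
    and X_gen: "\<And>i. gen n (X (Suc i)) = syz n (X i)"
    and X_elem: "\<And>i x k. x \<in> set (X (Suc i)) \<Longrightarrow> x \<in> free_mod n (length (X i)) \<and> homog 1 (x k)"
    using iterated_syzygies[OF lq] by metis
  define b where "b i = length (X i)" for i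
  define g where "g j = us ! j" for j
  define D where "D i j = X (Suc i) ! j" for i j
  define a where "a i j = int d + int i" for i j :: nat
  have D: "D i j \<in> free_mod n (b i)" "homog 1 (D i j k)" if "j < b (Suc i)" for i j k
    using X_elem[of "D i j" i] that by (auto simp: D_def b_def)
  have b0: "b 0 = length us" by (simp add: b_def X0)
  have g: "g j \<in> ext n \<and> homog d (g j)" if "j < b 0" for j
  proof -
    have "embed_vec (us ! j) \<in> set (map embed_vec us)" using that b0 by simp
    from linear_quotients_elem[OF lq this] have "embed_vec (g j) \<in> free_mod n 1" "homog d (embed_vec (g j) 0)"
      by (auto simp only: g_def)
    then show ?thesis by (simp only: embed_vec_closed embed_vec_0)
  qed
  have aug: "embed_vec (free_aug n (b 0) g x) = comb (length (X 0)) ((!) (X 0)) x" if "x \<in> free_mod n (b 0)" for x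
    using free_aug_eq_comb[OF _ that, of g] g comb_cong_upto[of "b 0" "\<lambda>j. embed_vec (g j)" "(!) (X 0)" x x]
    by (simp add: b_def g_def X0)
  have map: "free_map n (b (Suc i)) (D i) x = comb (length (X (Suc i))) ((!) (X (Suc i))) x"
    if "x \<in> free_mod n (b (Suc i))" for x i
    using free_map_eq_comb[OF _ that, of "D i" "b i"] D(1) comb_cong_upto[of "b (Suc i)" "D i" "(!) (X (Suc i))" x x]
    by (simp add: b_def D_def)
  have im: "free_map n (b (Suc i)) (D i) ` free_mod n (b (Suc i)) = syz n (X i)" for i
    unfolding X_gen[symmetric] gen_def b_def[symmetric] using map[of _ i] by (intro image_cong) (simp_all add: b_def)
  have zero: "(\<lambda>k::nat. \<zero>\<^bsub>exterior n\<^esub>) = (0 :: 'k vec)" by (auto simp: exterior_ops)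
  have "min_graded_free_resolution n I b a g D"
    unfolding min_graded_free_resolution_def
  proof (intro conjI allI impI)
    fix j assume "j < b 0"
    then show "g j \<in> ext n" "homogeneous (a 0 j) (g j)"
      using g homog_homogeneous[of d "g j"] by (auto simp: a_def)
  next
    fix i j assume j: "j < b (Suc i)"
    show "D i j \<in> free_mod n (b i)" using D(1)[OF j] .
    fix k
    show "homogeneous (a (Suc i) j - a i k) (D i j k)"
      using homog_homogeneous[OF D(2)[OF j]] by (simp add: a_def)
    have "S \<inter> {1..n} \<noteq> {}" if S: "D i j k S \<noteq> 0" for S
    proof -
      have "card S = 1" using D(2)[OF j, of k] S by (simp add: homog_def)
      moreover have "S \<subseteq> {1..n}" using D(1)[OF j] S by (auto simp: free_mod_iff ext_iff)
      ultimately show ?thesis by (metis card.empty inf.absorb1 zero_neq_one)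
    qed
    then show "D i j k \<in> irrelevant_ideal n"
      using D(1)[OF j] by (auto simp: irrelevant_ideal_eq var_ideal_def free_mod_iff)
  next
    have "embed_vec ` (free_aug n (b 0) g ` free_mod n (b 0)) = embed_vec ` I"
      unfolding I[symmetric] image_image X0[symmetric] gen_def b_def[symmetric]
      using aug by (intro image_cong) (simp_all add: b_def)
    moreover have "inj (embed_vec :: (nat set \<Rightarrow> 'k) \<Rightarrow> 'k vec)" by (rule injI) (simp add: embed_vec_simps)
    ultimately show "free_aug n (b 0) g ` free_mod n (b 0) = I" by (simp only: inj_image_eq_iff)
  next
    have "free_aug n (b 0) g x = 0 \<longleftrightarrow> comb (length (X 0)) ((!) (X 0)) x = 0" if "x \<in> free_mod n (b 0)" for x
      using aug[OF that] embed_vec_simps(4)[of "free_aug n (b 0) g x" 0] by simp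
    then show "free_map n (b 1) (D 0) ` free_mod n (b 1) =
        {x \<in> free_mod n (b 0). free_aug n (b 0) g x = \<zero>\<^bsub>exterior n\<^esub>}"
      using im[of 0] by (auto simp: syz_def exterior_ops b_def)
  next
    fix i
    show "free_map n (b (i + 2)) (D (i + 1)) ` free_mod n (b (i + 2)) =
        {x \<in> free_mod n (b (i + 1)). free_map n (b (i + 1)) (D i) x = (\<lambda>k. \<zero>\<^bsub>exterior n\<^esub>)}"
      unfolding zero using im[of "Suc i"] map[of _ i] by (auto simp: syz_def b_def)
  qed
  moreover have "b = (\<lambda>i. length ((split_bounds ^^ i) ms))" using len by (auto simp: b_def)
  ultimately show ?thesis by blast
qed

text \<open>
  The number of \<open>i\<close>-th syzygies that descend from one generator with bound \<open>m\<close>; equal to the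
  binomial coefficient \<open>m + i - 1\<close> over \<open>i\<close> for \<open>m \<ge> 1\<close>.
\<close>

fun var_syzygies :: "nat \<Rightarrow> nat \<Rightarrow> nat" where
  "var_syzygies 0 m = 1"
| "var_syzygies (Suc i) m = (\<Sum>l\<in>{1..m}. var_syzygies i l)"

lemma length_split_bounds: "length ((split_bounds ^^ i) ms) = sum_list (map (var_syzygies i) ms)"
proof (induction i arbitrary: ms)
  case 0
  show ?case by (induction ms) simp_all
next
  case (Suc i)
  have "length ((split_bounds ^^ Suc i) ms) = sum_list (map (var_syzygies i) (split_bounds ms))"
    using Suc by (simp add: funpow_swap1)
  also have "\<dots> = sum_list (map (var_syzygies (Suc i)) ms)"
    by (induction ms) (simp_all add: split_bounds_def sum_list_distinct_conv_sum_set atLeastLessThanSuc_atLeastAtMost del: upt_Suc)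
  finally show ?case .
qed

lemma var_syzygies_mono: "m \<le> m' \<Longrightarrow> var_syzygies i m \<le> var_syzygies i m'"
  by (cases i) (auto intro: sum_mono2)

text \<open>
  The formula of Aramova, Herzog and Hibi for stable ideals, in the case of generators of one degree.
  The list of generators is sorted by largest index, with ties in any order.
\<close>

theorem betti_stable:
  fixes G :: "nat set set"
  assumes G: "G \<subseteq> Mon n d" "1 \<le> d" "stable_set G"
    and I: "I = (Idl\<^bsub>exterior n\<^esub> (emon ` G) :: (nat set \<Rightarrow> 'k::field) set)"
  shows "betti n I i = (\<Sum>u\<in>G. var_syzygies i (Max u))"
proof -
  have sub: "G \<subseteq> Pow {1..n}" using G(1) by (auto simp: Mon_def)
  then have "finite G" using finite_subset by blast
  then obtain us where us0: "set us = G" "distinct us" using finite_distinct_list by blast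
  define vs where "vs = sort_key Max us"
  have vs: "set vs = G" "distinct vs" "sorted (map Max vs)" using us0 by (simp_all add: vs_def)
  have "linear_quotients n 1 d (map (\<lambda>u. embed_vec (emon u) :: 'k vec) vs) (map Max vs)"
    using vs G by (intro linear_quotients_monomials) (auto simp: Mon_def)
  moreover have "gen n (map (\<lambda>u. embed_vec (emon u) :: 'k vec) vs) = embed_vec ` I"
    unfolding I Idl_emon_eq[OF sub] using gen_monomials[of vs n] vs(1) sub by simp
  ultimately obtain a g D where
    "min_graded_free_resolution n I (\<lambda>i. length ((split_bounds ^^ i) (map Max vs))) a g D"
    using linear_quotients_resolution[of n d "map emon vs" "map Max vs" I] by (auto simp: comp_def)
  then have "betti n I i = sum_list (map (var_syzygies i) (map Max vs))"
    unfolding length_split_bounds[symmetric] by (rule betti_eq)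
  also have "\<dots> = (\<Sum>u\<in>G. var_syzygies i (Max u))"
    using vs by (simp add: sum_list_distinct_conv_sum_set comp_def)
  finally show ?thesis .
qed


section \<open>Colex segments\<close>

lemma Mon_finite: "finite (Mon n d)"
  unfolding Mon_def by (rule finite_subset[of _ "Pow {1..n}"]) auto

lemma Mon_sorted_list:
  assumes "\<sigma> \<in> Mon n d"
  shows "length (sorted_list_of_set \<sigma>) = d" "set (sorted_list_of_set \<sigma>) = \<sigma>"
proof -
  have "finite \<sigma>" using assms finite_subset[of \<sigma> "{1..n}"] by (auto simp: Mon_def)
  then show "length (sorted_list_of_set \<sigma>) = d" "set (sorted_list_of_set \<sigma>) = \<sigma>"
    using assms by (simp_all add: Mon_def)
qed

lemma Max_eq_last_index:
  assumes "\<sigma> \<in> Mon n d" "1 \<le> d"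
  shows "Max \<sigma> = sorted_list_of_set \<sigma> ! (d - 1)"
proof (rule Max_eqI)
  note l = Mon_sorted_list[OF assms(1)]
  show "finite \<sigma>" using l(2) finite_set by metis
  show "sorted_list_of_set \<sigma> ! (d - 1) \<in> \<sigma>"
    using l assms(2) nth_mem[of "d - 1" "sorted_list_of_set \<sigma>"] by simp
  fix x assume "x \<in> \<sigma>"
  then obtain i where "i < d" "x = sorted_list_of_set \<sigma> ! i"
    using l by (metis in_set_conv_nth)
  then show "x \<le> sorted_list_of_set \<sigma> ! (d - 1)"
    using l(1) sorted_nth_mono[of "sorted_list_of_set \<sigma>" i "d - 1"] by simp
qed

lemma revlex_gt_irrefl: "\<not> revlex_gt d \<sigma> \<sigma>"
  by (simp add: revlex_gt_def)

lemma revlex_gt_trans: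
  assumes "revlex_gt d \<rho> \<sigma>" "revlex_gt d \<sigma> \<tau>"
  shows "revlex_gt d \<rho> \<tau>"
proof -
  let ?l = "\<lambda>\<sigma>. (!) (sorted_list_of_set \<sigma>)"
  obtain s where s: "s < d" "\<And>t. s < t \<Longrightarrow> t < d \<Longrightarrow> ?l \<rho> t = ?l \<sigma> t" "?l \<rho> s < ?l \<sigma> s"
    using assms(1) by (auto simp: revlex_gt_def)
  obtain s' where s': "s' < d" "\<And>t. s' < t \<Longrightarrow> t < d \<Longrightarrow> ?l \<sigma> t = ?l \<tau> t" "?l \<sigma> s' < ?l \<tau> s'"
    using assms(2) by (auto simp: revlex_gt_def)
  have "?l \<rho> (max s s') < ?l \<tau> (max s s')"
    using s(2)[of s'] s(3) s'(1,2,3) s'(2)[of s] s(1) by (cases s s' rule: linorder_cases) auto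
  then show ?thesis
    unfolding revlex_gt_def using s(1,2) s'(1,2) by (intro exI[of _ "max s s'"]) auto
qed

lemma revlex_gt_total:
  assumes "\<sigma> \<in> Mon n d" "\<tau> \<in> Mon n d" "\<sigma> \<noteq> \<tau>"
  shows "revlex_gt d \<sigma> \<tau> \<or> revlex_gt d \<tau> \<sigma>"
proof -
  let ?l = "\<lambda>\<sigma>. (!) (sorted_list_of_set \<sigma>)"
  let ?D = "{s. s < d \<and> ?l \<sigma> s \<noteq> ?l \<tau> s}"
  note l = Mon_sorted_list[OF assms(1)] Mon_sorted_list[OF assms(2)]
  have "sorted_list_of_set \<sigma> \<noteq> sorted_list_of_set \<tau>" using l assms(3) by metis
  then have "?D \<noteq> {}" using l by (auto simp: list_eq_iff_nth_eq)
  define m where "m = Max ?D"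
  have "m \<in> ?D" unfolding m_def using \<open>?D \<noteq> {}\<close> by (intro Max_in) auto
  then have m: "m < d" "?l \<sigma> m < ?l \<tau> m \<or> ?l \<tau> m < ?l \<sigma> m" by auto
  have eq: "?l \<sigma> t = ?l \<tau> t" if t: "m < t" "t < d" for t
  proof (rule ccontr)
    assume "?l \<sigma> t \<noteq> ?l \<tau> t"
    then have "t \<le> m" unfolding m_def using t(2) by (intro Max_ge) auto
    then show False using t(1) by simp
  qed
  show ?thesis using m(2)
  proof
    assume "?l \<sigma> m < ?l \<tau> m"
    then show ?thesis unfolding revlex_gt_def using m(1) eq by (intro disjI1 exI[of _ m]) auto
  next
    assume "?l \<tau> m < ?l \<sigma> m"
    then show ?thesis unfolding revlex_gt_def using m(1) eq by (intro disjI2 exI[of _ m]) auto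
  qed
qed

lemma revlex_gt_Max:
  assumes "\<sigma> \<in> Mon n d" "\<tau> \<in> Mon n d" "1 \<le> d"
  shows "Max \<sigma> < Max \<tau> \<Longrightarrow> revlex_gt d \<sigma> \<tau>" "revlex_gt d \<sigma> \<tau> \<Longrightarrow> Max \<sigma> \<le> Max \<tau>"
proof -
  assume "Max \<sigma> < Max \<tau>"
  then show "revlex_gt d \<sigma> \<tau>"
    unfolding revlex_gt_def Max_eq_last_index[OF assms(1,3)] Max_eq_last_index[OF assms(2,3)]
    using assms(3) by (intro exI[of _ "d - 1"]) auto
next
  assume "revlex_gt d \<sigma> \<tau>"
  then obtain s where s: "s < d" "\<forall>t. s < t \<and> t < d \<longrightarrow> sorted_list_of_set \<sigma> ! t = sorted_list_of_set \<tau> ! t"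
    "sorted_list_of_set \<sigma> ! s < sorted_list_of_set \<tau> ! s"
    by (auto simp: revlex_gt_def)
  then show "Max \<sigma> \<le> Max \<tau>"
    unfolding Max_eq_last_index[OF assms(1,3)] Max_eq_last_index[OF assms(2,3)]
    by (cases "s = d - 1") auto
qed

text \<open>
  The number of predecessors is injective on a finite linear order, so it takes each value
  below \<open>card X\<close> exactly once.
\<close>

lemma card_first_elements:
  assumes fin: "finite X" and p: "p \<le> card X"
    and irrefl: "\<And>x. x \<in> X \<Longrightarrow> \<not> R x x"
    and trans: "\<And>x y z. R x y \<Longrightarrow> R y z \<Longrightarrow> R x z"
    and total: "\<And>x y. x \<in> X \<Longrightarrow> y \<in> X \<Longrightarrow> x \<noteq> y \<Longrightarrow> R x y \<or> R y x"
  shows "card {x \<in> X. card {y \<in> X. R y x} < p} = p"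
proof -
  define rk where "rk x = card {y \<in> X. R y x}" for x
  have rk_less: "rk x < rk y" if "x \<in> X" "R x y" for x y
  proof -
    have "{z \<in> X. R z x} \<subseteq> {z \<in> X. R z y}" using trans that(2) by blast
    moreover have "x \<in> {z \<in> X. R z y}" "x \<notin> {z \<in> X. R z x}" using that irrefl by auto
    ultimately have "{z \<in> X. R z x} \<subset> {z \<in> X. R z y}" by blast
    then show ?thesis unfolding rk_def using fin by (intro psubset_card_mono) auto
  qed
  have inj: "inj_on rk X"
    by (rule inj_onI) (metis rk_less less_irrefl total)
  have "rk x < card X" if "x \<in> X" for x
    unfolding rk_def using that irrefl fin by (intro psubset_card_mono psubsetI) auto
  then have "rk ` X = {..<card X}"
    using card_image[OF inj] by (intro card_subset_eq) auto
  moreover have "rk ` {x \<in> X. rk x < p} = rk ` X \<inter> {..<p}" by blast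
  ultimately have "rk ` {x \<in> X. rk x < p} = {..<p}" using p by auto
  moreover have "inj_on rk {x \<in> X. rk x < p}" using inj by (rule inj_on_subset) auto
  ultimately show ?thesis using card_image[of rk "{x \<in> X. rk x < p}"] by (simp add: rk_def)
qed

lemma card_largest_monomials:
  assumes "p \<le> card (Mon n d)"
  shows "card (largest_monomials n d p) = p"
  unfolding largest_monomials_def
  by (rule card_first_elements[OF Mon_finite assms])
    (use revlex_gt_irrefl revlex_gt_trans revlex_gt_total in blast)+

lemma largest_monomials_upward_closed:
  assumes "\<sigma> \<in> largest_monomials n d p" "\<tau> \<in> Mon n d" "revlex_gt d \<tau> \<sigma>"
  shows "\<tau> \<in> largest_monomials n d p"
proof -
  have "card {\<rho> \<in> Mon n d. revlex_gt d \<rho> \<tau>} \<le> card {\<rho> \<in> Mon n d. revlex_gt d \<rho> \<sigma>}"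
    using assms(3) revlex_gt_trans Mon_finite by (intro card_mono) auto
  then show ?thesis using assms(1,2) by (simp add: largest_monomials_def)
qed

text \<open>
  An exchange lowers the largest index, hence gives a larger monomial in the reverse lexicographic order.
\<close>

lemma stable_set_largest_monomials:
  assumes "1 \<le> d"
  shows "stable_set (largest_monomials n d p)"
  unfolding stable_set_def
proof (intro ballI impI)
  fix u i assume u: "u \<in> largest_monomials n d p" and i: "i \<in> {1..<Max u}" "i \<notin> u"
  have "u \<in> Mon n d" using u by (simp add: largest_monomials_def)
  note swap = swap_Mon[OF this assms i]
  show "insert i (u - {Max u}) \<in> largest_monomials n d p"
    using largest_monomials_upward_closed[OF u swap(1)] revlex_gt_Max(1)[OF swap(1) \<open>u \<in> Mon n d\<close> assms swap(2)]
    by blast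
qed

text \<open>
  Match \<open>A - B\<close> with \<open>B - A\<close> by any bijection.
\<close>

lemma sum_le_sum_of_dominated:
  fixes h :: "'a \<Rightarrow> nat"
  assumes "finite A" "finite B" "card A = card B" "\<And>x y. x \<in> A - B \<Longrightarrow> y \<in> B - A \<Longrightarrow> h x \<le> h y"
  shows "sum h A \<le> sum h B"
proof -
  have "card (A - B) = card (B - A)"
    using assms(1-3) by (simp add: card_Diff_subset_Int Int_commute)
  then obtain \<pi> where \<pi>: "bij_betw \<pi> (A - B) (B - A)"
    using finite_same_card_bij assms(1,2) by blast
  have "sum h (A - B) \<le> (\<Sum>x\<in>A - B. h (\<pi> x))"
    using assms(4) \<pi> by (intro sum_mono) (auto dest: bij_betwE)
  also have "\<dots> = sum h (B - A)" using \<pi> by (rule sum.reindex_bij_betw)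
  finally have "sum h (A \<inter> B) + sum h (A - B) \<le> sum h (B \<inter> A) + sum h (B - A)"
    by (simp add: Int_commute)
  then show ?thesis using sum.Int_Diff[of A h B] sum.Int_Diff[of B h A] assms(1,2) by simp
qed

text \<open>
  Strong stability puts the exchanged monomial into \<open>I\<close>; since it has degree \<open>d\<close>, like all minimal
  generators, the generator dividing it can only be that monomial itself.
\<close>

lemma stable_set_min_gens:
  fixes I :: "(nat set \<Rightarrow> 'k::field) set"
  assumes stable: "strongly_stable n I" and deg: "generated_in_degree n d I"
  shows "stable_set (min_gens n I)"
  unfolding stable_set_def
proof (intro ballI impI)
  fix u i assume u: "u \<in> min_gens n I" and i: "i \<in> {1..<Max u}" "i \<notin> u"
  have G: "min_gens n I \<subseteq> Mon n d" "1 \<le> d"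
    using deg by (auto simp: generated_in_degree_def min_gens_def Mon_def)
  have u_Mon: "u \<in> Mon n d" using G(1) u by blast
  note v = swap_Mon(1)[OF u_Mon G(2) i]
  have fin_u: "finite u" and "u \<noteq> {}"
    using u_Mon G(2) finite_subset[of u "{1..n}"] by (auto simp: Mon_def)
  then have "Max u \<in> u" by simp
  let ?v = "insert i (u - {Max u})" and ?f = "emon {i} \<otimes>\<^bsub>exterior n\<^esub> emon (u - {Max u}) :: nat set \<Rightarrow> 'k"
  have "?f \<in> I"
    using stable u i(1) \<open>Max u \<in> u\<close> unfolding strongly_stable_def min_gens_def by blast
  moreover have "I = monomial_span n (min_gens n I)"
    using stable min_gens_generate[of n I] Idl_emon_eq[of "min_gens n I" n, where 'k = 'k]
    by (auto simp: strongly_stable_def min_gens_def)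
  ultimately have f: "?f \<in> monomial_span n (min_gens n I)" by (simp only:)
  have "?f ?v = wedge_sign {i} (u - {Max u})"
    using i(2) fin_u by (simp add: emon_mult) (simp add: emon_def)
  then have "?f ?v \<noteq> 0" by (simp add: wedge_sign_def)
  then obtain w where w: "w \<in> min_gens n I" "w \<subseteq> ?v"
    using f unfolding monomial_span_def by blast
  then have "card w = card (insert i (u - {Max u}))" using v G(1) by (auto simp: Mon_def)
  then have "w = insert i (u - {Max u})" using w(2) fin_u by (intro card_subset_eq) auto
  then show "insert i (u - {Max u}) \<in> min_gens n I" using w(1) by simp
qed

theorem theorem5p2:
  fixes n d :: nat and I J :: "(nat set \<Rightarrow> 'k::field) set"
  assumes "I \<subset> carrier (exterior n)"
    and "strongly_stable n I"
    and "generated_in_degree n d I"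
    and "J = colexsegment_ideal n d I"
  shows "\<forall>i. betti n J i \<le> betti n I i"
proof
  fix i
  let ?G = "min_gens n I" and ?H = "largest_monomials n d (card (min_gens n I))"
  have d: "1 \<le> d" and G: "?G \<subseteq> Mon n d"
    using assms(3) by (auto simp: generated_in_degree_def min_gens_def Mon_def)
  have H: "?H \<subseteq> Mon n d" by (auto simp: largest_monomials_def)
  have fin: "finite ?G" "finite ?H" using G H Mon_finite finite_subset by blast+
  have card: "card ?H = card ?G" using G Mon_finite by (intro card_largest_monomials card_mono)
  have I: "betti n I i = (\<Sum>u\<in>?G. var_syzygies i (Max u))"
    using assms(2) min_gens_generate[of n I]
    by (intro betti_stable[OF G d stable_set_min_gens[OF assms(2,3)]]) (simp add: strongly_stable_def)
  have J: "betti n J i = (\<Sum>u\<in>?H. var_syzygies i (Max u))"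
    using assms(4) by (intro betti_stable[OF H d stable_set_largest_monomials[OF d]]) (simp add: colexsegment_ideal_def)
  have "var_syzygies i (Max u) \<le> var_syzygies i (Max v)" if "u \<in> ?H - ?G" "v \<in> ?G - ?H" for u v
  proof -
    have "u \<in> Mon n d" "v \<in> Mon n d" "u \<noteq> v" using that G H by auto
    moreover have "\<not> revlex_gt d v u"
      using that largest_monomials_upward_closed[of u n d _ v] \<open>v \<in> Mon n d\<close> by blast
    ultimately have "Max u \<le> Max v" using revlex_gt_total revlex_gt_Max(2) d by blast
    then show ?thesis by (rule var_syzygies_mono)
  qed
  then show "betti n J i \<le> betti n I i"
    unfolding I J by (intro sum_le_sum_of_dominated[OF fin(2,1) card])
qed

end
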